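(* After Moser regularization, the (spatial) negative energy Kepler problem is a strictly convex contact-type hypersurface in $(T^*S^3,\omega_{std})$.
   Context: **Kepler problem and Moser regularization.** The spatial Kepler problem is the Hamiltonian system on $T^*(\mathbb R^3\setminus\{0\})$ given by $E(q,p)=\tfrac12\|p\|^2-\tfrac1{\|q\|}$. For a negative energy value, Moser regularization (interchanging the roles of $q$ and $p$, viewing the suitably rescaled $p$ as a base coordinate in a stereographic chart of $S^3$ and $q$ as the cotangent fiber coordinate, and compactifying at $p=\infty$, i.e. at collisions) turns the energy level set into the unit cotangent bundle $S^*S^3\subset T^*S^3$ of the round metric, on which the flow is, up to time reparametrization, the geodesic flow of the round metric on $S^3$. The regularized problem is this hypersurface $S^*S^3=Q^{-1}(1/2)$, $Q=\frac12\|\eta\|^2$, where $$T^*S^3=\{(\xi;\eta)\in\mathbb R^4\oplus\mathbb R^4:\|\xi\|=1,\ \langle\xi,\eta\rangle=0\},\qquad \omega_{std}=d\xi\wedge d\eta|_{T^*S^3}.$$ **Strict convexity.** Let $(M,\alpha)$ be a strict contact-type hypersurface in a symplectic manifold $(W,\omega)$. It (or its Reeb flow) is strictly convex if $M=H^{-1}(0)$ for a $C^2$ Hamiltonian $H:(-\epsilon,\epsilon)\times M\subset W\to\mathbb R$ defined near $M$ such that the Hessian $\nabla^2H|_M=\nabla(dH)|_M:TM\to T^*M$ (the restriction of $\nabla dH$ to $TM$) is positive definite; here $\nabla$ is the Levi-Civita connection of some ambient metric on $W$. *)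

theory Defs
  imports "HOL-Analysis.Analysis"
begin

text \<open>Manifolds are submanifolds (in Milnor's sense) of a Euclidean space, and tensors on a
  submanifold \<open>W\<close> are given by ambient multilinear forms of which only the restriction to the
  tangent spaces of \<open>W\<close> is ever used; every tensor on \<open>W\<close> is of this form.\<close>

section \<open>Maps of class \<open>C\<^sup>k\<close>\<close>

text \<open>Only meaningful for open \<open>U\<close>. In finite dimension, \<open>x \<mapsto> Df(x)\<close> is of class \<open>C\<^sup>k\<close> iff
  \<open>x \<mapsto> Df(x) v\<close> is, for every fixed \<open>v\<close>.\<close>

primrec Ck_on :: "nat \<Rightarrow> 'a::euclidean_space set \<Rightarrow> ('a \<Rightarrow> 'b::euclidean_space) \<Rightarrow> bool" where
  "Ck_on 0 U f \<longleftrightarrow> continuous_on U f"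
| "Ck_on (Suc k) U f \<longleftrightarrow> (\<forall>x\<in>U. f differentiable (at x)) \<and>
     (\<forall>v. Ck_on k U (\<lambda>x. frechet_derivative f (at x) v))"

text \<open>Maps on arbitrary subsets \<open>W\<close>: those that extend locally to maps on open sets.\<close>

definition Ck_map :: "nat \<Rightarrow> 'a::euclidean_space set \<Rightarrow> ('a \<Rightarrow> 'b::euclidean_space) \<Rightarrow> bool" where
  "Ck_map k W f \<longleftrightarrow>
     (\<forall>x\<in>W. \<exists>U F. open U \<and> x \<in> U \<and> Ck_on k U F \<and> (\<forall>y\<in>U \<inter> W. F y = f y))"

definition smooth_map :: "'a::euclidean_space set \<Rightarrow> ('a \<Rightarrow> 'b::euclidean_space) \<Rightarrow> bool" where
  "smooth_map W f \<longleftrightarrow>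
     (\<forall>x\<in>W. \<exists>U F. open U \<and> x \<in> U \<and> (\<forall>k. Ck_on k U F) \<and> (\<forall>y\<in>U \<inter> W. F y = f y))"

definition diffeo_betw ::
    "'a::euclidean_space set \<Rightarrow> 'b::euclidean_space set \<Rightarrow> ('a \<Rightarrow> 'b) \<Rightarrow> bool" where
  "diffeo_betw A B f \<longleftrightarrow> bij_betw f A B \<and> smooth_map A f \<and> smooth_map B (inv_into A f)"


section \<open>Submanifolds, tangent spaces, vector fields\<close>

definition submanifold :: "nat \<Rightarrow> 'a::euclidean_space set \<Rightarrow> bool" where
  "submanifold d W \<longleftrightarrow>
     (\<forall>x\<in>W. \<exists>N S A \<phi>. openin (top_of_set W) N \<and> x \<in> N \<and>
        subspace S \<and> dim S = d \<and> openin (top_of_set S) (A :: 'a set) \<and> diffeo_betw A N \<phi>)"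

definition tangent_space :: "'a::euclidean_space set \<Rightarrow> 'a \<Rightarrow> 'a set" where
  "tangent_space W x =
     {v. \<exists>e>0. \<exists>\<gamma>. smooth_map {-e<..<e::real} \<gamma> \<and> \<gamma> ` {-e<..<e} \<subseteq> W \<and> \<gamma> 0 = x \<and>
        (\<gamma> has_vector_derivative v) (at 0)}"

definition vector_field :: "'a::euclidean_space set \<Rightarrow> ('a \<Rightarrow> 'a) \<Rightarrow> bool" where
  "vector_field W X \<longleftrightarrow> smooth_map W X \<and> (\<forall>x\<in>W. X x \<in> tangent_space W x)"

text \<open>The derivative of \<open>f\<close> along \<open>X\<close>. A derivative within a submanifold \<open>W\<close> is uniquely
  determined on the tangent space only, so \<open>dird\<close> is to be used for fields tangent to \<open>W\<close>.\<close>

definition dird :: "'a::euclidean_space set \<Rightarrow> ('a \<Rightarrow> 'a) \<Rightarrow> ('a \<Rightarrow> 'b::euclidean_space) \<Rightarrow> 'a \<Rightarrow> 'b"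
  where "dird W X f x = frechet_derivative f (at x within W) (X x)"

definition lie_bracket :: "'a::euclidean_space set \<Rightarrow> ('a \<Rightarrow> 'a) \<Rightarrow> ('a \<Rightarrow> 'a) \<Rightarrow> 'a \<Rightarrow> 'a" where
  "lie_bracket W X Y x = dird W X Y x - dird W Y X x"

definition smooth_bilinear_form :: "'a::euclidean_space set \<Rightarrow> ('a \<Rightarrow> 'a \<Rightarrow> 'a \<Rightarrow> real) \<Rightarrow> bool" where
  "smooth_bilinear_form W b \<longleftrightarrow> (\<forall>x\<in>W. bilinear (b x)) \<and>
     (\<forall>X Y. vector_field W X \<longrightarrow> vector_field W Y \<longrightarrow> smooth_map W (\<lambda>x. b x (X x) (Y x)))"


section \<open>Riemannian metrics, the Levi-Civita connection, the Hessian\<close>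

definition riemannian_metric :: "'a::euclidean_space set \<Rightarrow> ('a \<Rightarrow> 'a \<Rightarrow> 'a \<Rightarrow> real) \<Rightarrow> bool" where
  "riemannian_metric W g \<longleftrightarrow> smooth_bilinear_form W g \<and>
     (\<forall>x\<in>W. \<forall>u\<in>tangent_space W x. \<forall>v\<in>tangent_space W x. g x u v = g x v u) \<and>
     (\<forall>x\<in>W. \<forall>v\<in>tangent_space W x. v \<noteq> 0 \<longrightarrow> g x v v > 0)"

definition affine_connection ::
    "'a::euclidean_space set \<Rightarrow> (('a \<Rightarrow> 'a) \<Rightarrow> ('a \<Rightarrow> 'a) \<Rightarrow> ('a \<Rightarrow> 'a)) \<Rightarrow> bool" where
  "affine_connection W D \<longleftrightarrow>
     (\<forall>X Y. vector_field W X \<longrightarrow> vector_field W Y \<longrightarrow> vector_field W (D X Y)) \<and>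
     (\<forall>X X' Y. vector_field W X \<longrightarrow> vector_field W X' \<longrightarrow> vector_field W Y \<longrightarrow>
        (\<forall>x\<in>W. D (\<lambda>z. X z + X' z) Y x = D X Y x + D X' Y x)) \<and>
     (\<forall>X Y Y'. vector_field W X \<longrightarrow> vector_field W Y \<longrightarrow> vector_field W Y' \<longrightarrow>
        (\<forall>x\<in>W. D X (\<lambda>z. Y z + Y' z) x = D X Y x + D X Y' x)) \<and>
     (\<forall>f X Y. smooth_map W f \<longrightarrow> vector_field W X \<longrightarrow> vector_field W Y \<longrightarrow>
        (\<forall>x\<in>W. D (\<lambda>z. f z *\<^sub>R X z) Y x = f x *\<^sub>R D X Y x)) \<and>
     (\<forall>f X Y. smooth_map W f \<longrightarrow> vector_field W X \<longrightarrow> vector_field W Y \<longrightarrow>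
        (\<forall>x\<in>W. D X (\<lambda>z. f z *\<^sub>R Y z) x = dird W X f x *\<^sub>R Y x + f x *\<^sub>R D X Y x))"

definition levi_civita ::
    "'a::euclidean_space set \<Rightarrow> ('a \<Rightarrow> 'a \<Rightarrow> 'a \<Rightarrow> real) \<Rightarrow>
     (('a \<Rightarrow> 'a) \<Rightarrow> ('a \<Rightarrow> 'a) \<Rightarrow> ('a \<Rightarrow> 'a)) \<Rightarrow> bool" where
  "levi_civita W g D \<longleftrightarrow> affine_connection W D \<and>
     (\<forall>X Y. vector_field W X \<longrightarrow> vector_field W Y \<longrightarrow>
        (\<forall>x\<in>W. D X Y x - D Y X x = lie_bracket W X Y x)) \<and>
     (\<forall>X Y Z. vector_field W X \<longrightarrow> vector_field W Y \<longrightarrow> vector_field W Z \<longrightarrow>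
        (\<forall>x\<in>W. dird W Z (\<lambda>z. g z (X z) (Y z)) x = g x (D Z X x) (Y x) + g x (X x) (D Z Y x)))"

text \<open>\<open>(\<nabla>dH)(X, Y) = X(dH(Y)) - dH(\<nabla>\<^sub>X Y)\<close>\<close>

definition hessian ::
    "'a::euclidean_space set \<Rightarrow> (('a \<Rightarrow> 'a) \<Rightarrow> ('a \<Rightarrow> 'a) \<Rightarrow> ('a \<Rightarrow> 'a)) \<Rightarrow> ('a \<Rightarrow> real) \<Rightarrow>
     ('a \<Rightarrow> 'a) \<Rightarrow> ('a \<Rightarrow> 'a) \<Rightarrow> 'a \<Rightarrow> real" where
  "hessian W D H X Y x = dird W X (dird W Y H) x - dird W (D X Y) H x"


section \<open>Symplectic forms and contact-type hypersurfaces\<close>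

definition symplectic_form :: "'a::euclidean_space set \<Rightarrow> ('a \<Rightarrow> 'a \<Rightarrow> 'a \<Rightarrow> real) \<Rightarrow> bool" where
  "symplectic_form W \<omega> \<longleftrightarrow> smooth_bilinear_form W \<omega> \<and>
     (\<forall>x\<in>W. \<forall>v\<in>tangent_space W x. \<omega> x v v = 0) \<and>
     (\<forall>x\<in>W. \<forall>u\<in>tangent_space W x. u \<noteq> 0 \<longrightarrow> (\<exists>v\<in>tangent_space W x. \<omega> x u v \<noteq> 0)) \<and>
     (\<forall>X Y Z. vector_field W X \<longrightarrow> vector_field W Y \<longrightarrow> vector_field W Z \<longrightarrow>
        (\<forall>x\<in>W. dird W X (\<lambda>z. \<omega> z (Y z) (Z z)) x
             + dird W Y (\<lambda>z. \<omega> z (Z z) (X z)) x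
             + dird W Z (\<lambda>z. \<omega> z (X z) (Y z)) x
             - \<omega> x (lie_bracket W X Y x) (Z x)
             - \<omega> x (lie_bracket W Y Z x) (X x)
             - \<omega> x (lie_bracket W Z X x) (Y x) = 0))"

text \<open>\<open>L\<^sub>V \<omega> = \<omega>\<close>\<close>

definition liouville_field ::
    "'a::euclidean_space set \<Rightarrow> ('a \<Rightarrow> 'a \<Rightarrow> 'a \<Rightarrow> real) \<Rightarrow> ('a \<Rightarrow> 'a) \<Rightarrow> bool" where
  "liouville_field W \<omega> V \<longleftrightarrow> vector_field W V \<and>
     (\<forall>X Y. vector_field W X \<longrightarrow> vector_field W Y \<longrightarrow>
        (\<forall>x\<in>W. dird W V (\<lambda>z. \<omega> z (X z) (Y z)) x
             - \<omega> x (lie_bracket W V X x) (Y x) - \<omega> x (X x) (lie_bracket W V Y x)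
             = \<omega> x (X x) (Y x)))"

text \<open>The induced contact form on \<open>M\<close> is \<open>\<omega>(V, \<cdot>)\<close>.\<close>

definition contact_type_hypersurface ::
    "'a::euclidean_space set \<Rightarrow> ('a \<Rightarrow> 'a \<Rightarrow> 'a \<Rightarrow> real) \<Rightarrow> 'a set \<Rightarrow> bool" where
  "contact_type_hypersurface W \<omega> M \<longleftrightarrow> symplectic_form W \<omega> \<and> M \<subseteq> W \<and>
     (\<exists>d. submanifold (Suc d) W \<and> submanifold d M) \<and>
     (\<exists>U V. openin (top_of_set W) U \<and> M \<subseteq> U \<and> liouville_field U \<omega> V \<and>
        (\<forall>x\<in>M. V x \<notin> tangent_space M x))"

text \<open>\<open>U\<close> is the neighbourhood \<open>(-\<epsilon>, \<epsilon>) \<times> M \<subseteq> W\<close>, embedded by \<open>\<Phi>\<close>; every tangent vector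
  of \<open>W\<close> is the value of a vector field, so the last clause is positive definiteness on \<open>TM\<close>.\<close>

definition strictly_convex_hypersurface :: "'a::euclidean_space set \<Rightarrow> 'a set \<Rightarrow> bool" where
  "strictly_convex_hypersurface W M \<longleftrightarrow>
     (\<exists>\<epsilon>>0. \<exists>(\<Phi> :: real \<times> 'a \<Rightarrow> 'a) U H g D.
        diffeo_betw ({-\<epsilon><..<\<epsilon>} \<times> M) U \<Phi> \<and> (\<forall>x\<in>M. \<Phi> (0, x) = x) \<and>
        openin (top_of_set W) U \<and>
        Ck_map 2 U H \<and> M = {x \<in> U. H x = 0} \<and>
        riemannian_metric W g \<and> levi_civita W g D \<and>
        (\<forall>x\<in>M. \<forall>X. vector_field W X \<longrightarrow> X x \<in> tangent_space M x \<longrightarrow> X x \<noteq> 0 \<longrightarrow>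
           hessian W D H X X x > 0))"


section \<open>The Kepler problem and its Moser regularization\<close>

definition cotangent_S3 :: "((real^4) \<times> (real^4)) set" where
  "cotangent_S3 = {(\<xi>, \<eta>). norm \<xi> = 1 \<and> \<xi> \<bullet> \<eta> = 0}"

definition omega_std :: "(real^4) \<times> (real^4) \<Rightarrow> (real^4) \<times> (real^4) \<Rightarrow> (real^4) \<times> (real^4) \<Rightarrow> real" where
  "omega_std x u v = fst u \<bullet> snd v - fst v \<bullet> snd u"

definition kepler_energy :: "real^3 \<Rightarrow> real^3 \<Rightarrow> real" where
  "kepler_energy q p = (norm p)\<^sup>2 / 2 - 1 / norm q"

definition kepler_level :: "real \<Rightarrow> ((real^3) \<times> (real^3)) set" where
  "kepler_level c = {(q, p). q \<noteq> 0 \<and> kepler_energy q p = c}"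

text \<open>The inverse stereographic projection \<open>y \<mapsto> \<xi>\<close> from the pole \<open>(1,0,0,0)\<close> and the induced
  map \<open>x \<mapsto> \<eta>\<close> of cotangent fibres, determined by \<open>\<eta> \<bullet> d\<xi> = x \<bullet> dy\<close>.\<close>

definition stereographic_lift :: "real^3 \<Rightarrow> real^3 \<Rightarrow> (real^4) \<times> (real^4)" where
  "stereographic_lift y x =
     (let s = (norm y)\<^sup>2 + 1; r = x \<bullet> y in
       (vector [((norm y)\<^sup>2 - 1) / s, 2 * y$1 / s, 2 * y$2 / s, 2 * y$3 / s],
        vector [r, s / 2 * x$1 - r * y$1, s / 2 * x$2 - r * y$2, s / 2 * x$3 - r * y$3]))"

text \<open>With \<open>k = sqrt (-2c)\<close>, the base coordinate is \<open>y = p / k\<close> and the fibre coordinate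
  \<open>x = -k\<^sup>2 q\<close>; this pulls \<open>\<omega>\<^sub>s\<^sub>t\<^sub>d\<close> back to \<open>k dq \<and> dp\<close>.\<close>

definition moser_map :: "real \<Rightarrow> (real^3) \<times> (real^3) \<Rightarrow> (real^4) \<times> (real^4)" where
  "moser_map c = (\<lambda>(q, p). stereographic_lift ((1 / sqrt (-2 * c)) *\<^sub>R p) ((2 * c) *\<^sub>R q))"

text \<open>Taking the closure adds the collisions \<open>p = \<infinity>\<close>, i.e. the fibre over the pole.\<close>

definition moser_regularization :: "real \<Rightarrow> ((real^4) \<times> (real^4)) set" where
  "moser_regularization c = closure (moser_map c ` kepler_level c)"

lemma vector_4:
  "(vector [a,b,c,d] :: 'a::zero^4)$1 = a" "(vector [a,b,c,d] :: 'a::zero^4)$2 = b"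
  "(vector [a,b,c,d] :: 'a::zero^4)$3 = c" "(vector [a,b,c,d] :: 'a::zero^4)$4 = d"
  unfolding vector_def by simp_all

lemma stereographic_lift_in:
  assumes "((norm y)\<^sup>2 + 1) * norm x = 2"
  shows "stereographic_lift y x \<in> cotangent_S3" "norm (snd (stereographic_lift y x)) = 1"
proof -
  define s r where "s = (norm y)\<^sup>2 + 1" and "r = x \<bullet> y"
  define \<xi> \<eta> :: "real^4" where
    "\<xi> = vector [((norm y)\<^sup>2 - 1) / s, 2 * y$1 / s, 2 * y$2 / s, 2 * y$3 / s]" and
    "\<eta> = vector [r, s / 2 * x$1 - r * y$1, s / 2 * x$2 - r * y$2, s / 2 * x$3 - r * y$3]"
  have lift: "stereographic_lift y x = (\<xi>, \<eta>)"
    by (simp add: stereographic_lift_def \<xi>_def \<eta>_def s_def r_def Let_def)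
  have s0: "s > 0" by (simp add: s_def add_nonneg_pos)
  have ny: "y$1 * y$1 + y$2 * y$2 + y$3 * y$3 = s - 1"
    by (simp add: s_def power2_norm_eq_inner inner_vec_def sum_3)
  have nx: "x$1 * x$1 + x$2 * x$2 + x$3 * x$3 = (norm x)\<^sup>2"
    by (simp add: power2_norm_eq_inner inner_vec_def sum_3)
  have xy: "x$1 * y$1 + x$2 * y$2 + x$3 * y$3 = r"
    by (simp add: r_def inner_vec_def sum_3)
  have \<xi>: "\<xi> = (1 / s) *\<^sub>R vector [s - 2, 2 * y$1, 2 * y$2, 2 * y$3]"
    by (simp add: \<xi>_def vec_eq_iff forall_4 vector_4 s_def)
  have "\<xi> \<bullet> \<xi> = (1 / s)\<^sup>2 * ((s - 2)\<^sup>2 + 4 * (y$1 * y$1 + y$2 * y$2 + y$3 * y$3))"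
    unfolding \<xi> inner_scaleR_left inner_scaleR_right power2_eq_square[of "1 / s"] mult.assoc
    by (intro arg_cong[where f = "(*) (1 / s)"])
      (simp add: inner_vec_def sum_4 vector_4 power2_eq_square algebra_simps)
  also have "\<dots> = 1"
  proof -
    have "(s - 2)\<^sup>2 + 4 * (s - 1) = s\<^sup>2" by (simp add: power2_eq_square algebra_simps)
    then show ?thesis using s0 unfolding ny by (simp add: power_divide)
  qed
  finally have 1: "norm \<xi> = 1" by (simp add: norm_eq_sqrt_inner)
  have "\<xi> \<bullet> \<eta> = (1 / s) * ((s - 2) * r + s * (x$1 * y$1 + x$2 * y$2 + x$3 * y$3)
       - 2 * r * (y$1 * y$1 + y$2 * y$2 + y$3 * y$3))"
    unfolding \<xi> inner_scaleR_left
    by (rule arg_cong[where f = "(*) (1 / s)"])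
      (simp add: \<eta>_def inner_vec_def sum_4 vector_4 algebra_simps)
  also have "\<dots> = 0" unfolding ny xy by (simp add: algebra_simps)
  finally have 2: "\<xi> \<bullet> \<eta> = 0" .
  have "\<eta> \<bullet> \<eta> = r\<^sup>2 + (s / 2)\<^sup>2 * (x$1 * x$1 + x$2 * x$2 + x$3 * x$3)
      - s * r * (x$1 * y$1 + x$2 * y$2 + x$3 * y$3)
      + r\<^sup>2 * (y$1 * y$1 + y$2 * y$2 + y$3 * y$3)"
    by (simp add: \<eta>_def inner_vec_def sum_4 vector_4 power2_eq_square field_simps)
  also have "\<dots> = (s * norm x / 2)\<^sup>2"
    unfolding nx ny xy by (simp add: power2_eq_square field_simps)
  also have "\<dots> = 1" using assms by (simp add: s_def)
  finally have 3: "norm \<eta> = 1" by (simp add: norm_eq_sqrt_inner)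
  show "stereographic_lift y x \<in> cotangent_S3" "norm (snd (stereographic_lift y x)) = 1"
    using 1 2 3 by (simp_all add: lift cotangent_S3_def)
qed

lemma stereographic_lift_onto:
  assumes w: "(\<xi>, \<eta>) \<in> cotangent_S3" "norm \<eta> = 1" and "\<xi>$1 \<noteq> 1"
  obtains y x where "stereographic_lift y x = (\<xi>, \<eta>)" "((norm y)\<^sup>2 + 1) * norm x = 2"
proof -
  obtain t where \<xi>1: "\<xi>$1 = 1 - t"
  proof
    show "\<xi>$1 = 1 - (1 - \<xi>$1)" by simp
  qed
  define y x :: "real^3" where
    "y = vector [\<xi>$2 / t, \<xi>$3 / t, \<xi>$4 / t]" and
    "x = vector [t * \<eta>$2 + \<eta>$1 * \<xi>$2, t * \<eta>$3 + \<eta>$1 * \<xi>$3, t * \<eta>$4 + \<eta>$1 * \<xi>$4]"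
  have n\<xi>: "\<xi>$2 * \<xi>$2 + \<xi>$3 * \<xi>$3 + \<xi>$4 * \<xi>$4 = t * (2 - t)"
    using w(1) by (simp add: cotangent_S3_def norm_eq_1 inner_vec_def sum_4 \<xi>1 algebra_simps)
  have n\<eta>: "\<eta>$2 * \<eta>$2 + \<eta>$3 * \<eta>$3 + \<eta>$4 * \<eta>$4 = 1 - \<eta>$1 * \<eta>$1"
    using w(2) by (simp add: norm_eq_1 inner_vec_def sum_4)
  have ip: "\<xi>$2 * \<eta>$2 + \<xi>$3 * \<eta>$3 + \<xi>$4 * \<eta>$4 = - (1 - t) * \<eta>$1"
    using w(1) by (simp add: cotangent_S3_def inner_vec_def sum_4 \<xi>1 algebra_simps)
  have "\<bar>\<xi>$1\<bar> \<le> 1"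
    using component_le_norm_cart[of \<xi> 1] w(1) by (simp add: cotangent_S3_def)
  then have t0: "t > 0" using assms(3) by (simp add: \<xi>1)
  have "(norm y)\<^sup>2 = (\<xi>$2 * \<xi>$2 + \<xi>$3 * \<xi>$3 + \<xi>$4 * \<xi>$4) / t\<^sup>2"
    unfolding power2_norm_eq_inner
    by (simp add: y_def inner_vec_def sum_3 add_divide_distrib power2_eq_square)
  also have "\<dots> = (2 - t) / t" unfolding n\<xi> using t0 by (simp add: power2_eq_square)
  finally have ny: "(norm y)\<^sup>2 = (2 - t) / t" .
  then have s: "(norm y)\<^sup>2 + 1 = 2 / t" using t0 by (simp add: field_simps)
  have "x \<bullet> y = (t * (\<xi>$2 * \<eta>$2 + \<xi>$3 * \<eta>$3 + \<xi>$4 * \<eta>$4)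
      + \<eta>$1 * (\<xi>$2 * \<xi>$2 + \<xi>$3 * \<xi>$3 + \<xi>$4 * \<xi>$4)) / t"
    by (simp add: x_def y_def inner_vec_def sum_3 add_divide_distrib algebra_simps)
  also have "\<dots> = \<eta>$1" unfolding n\<xi> ip using t0 by (simp add: field_simps)
  finally have r: "x \<bullet> y = \<eta>$1" .
  have "(norm x)\<^sup>2 = t\<^sup>2 * (\<eta>$2 * \<eta>$2 + \<eta>$3 * \<eta>$3 + \<eta>$4 * \<eta>$4)
      + 2 * t * \<eta>$1 * (\<xi>$2 * \<eta>$2 + \<xi>$3 * \<eta>$3 + \<xi>$4 * \<eta>$4)
      + (\<eta>$1)\<^sup>2 * (\<xi>$2 * \<xi>$2 + \<xi>$3 * \<xi>$3 + \<xi>$4 * \<xi>$4)"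
    unfolding power2_norm_eq_inner
    by (simp add: x_def inner_vec_def sum_3 power2_eq_square algebra_simps)
  also have "\<dots> = t\<^sup>2" unfolding n\<xi> n\<eta> ip by (simp add: power2_eq_square algebra_simps)
  finally have nx: "norm x = t" using t0 by simp
  have "stereographic_lift y x = (\<xi>, \<eta>)"
    unfolding stereographic_lift_def Let_def s r ny
    using t0 by (simp add: vec_eq_iff forall_4 vector_4 x_def y_def \<xi>1)
      (simp add: field_simps)
  moreover have "((norm y)\<^sup>2 + 1) * norm x = 2" using t0 by (simp add: s nx)
  ultimately show ?thesis by (rule that)
qed

lemma kepler_level_iff:
  assumes "c < 0"
  shows "(q, p) \<in> kepler_level c \<longleftrightarrow>
    ((norm ((1 / sqrt (-2 * c)) *\<^sub>R p))\<^sup>2 + 1) * norm ((2 * c) *\<^sub>R q) = 2"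
proof (cases "q = 0")
  case True
  then show ?thesis by (simp add: kepler_level_def)
next
  case False
  have "(norm ((1 / sqrt (-2 * c)) *\<^sub>R p))\<^sup>2 = (norm p)\<^sup>2 / (-2 * c)"
    using assms by (simp add: power_divide)
  then have "((norm ((1 / sqrt (-2 * c)) *\<^sub>R p))\<^sup>2 + 1) * norm ((2 * c) *\<^sub>R q)
      = ((norm p)\<^sup>2 - 2 * c) * norm q"
    using assms by (simp add: field_simps)
  moreover have "(norm p)\<^sup>2 / 2 - 1 / norm q = c \<longleftrightarrow> ((norm p)\<^sup>2 - 2 * c) * norm q = 2"
    using False by (simp add: field_simps)
  ultimately show ?thesis
    using False by (simp only: kepler_level_def kepler_energy_def mem_Collect_eq prod.case) simp
qed

text \<open>The regularized level set is the unit cotangent bundle \<open>Q\<^sup>-\<^sup>1(1/2)\<close>, \<open>Q = \<parallel>\<eta>\<parallel>\<^sup>2 / 2\<close>.\<close>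

lemma moser_regularization_eq:
  assumes c: "c < 0"
  shows "moser_regularization c = {(\<xi>, \<eta>) \<in> cotangent_S3. (norm \<eta>)\<^sup>2 / 2 = 1 / 2}"
proof -
  define S where "S = {(\<xi>, \<eta>) \<in> cotangent_S3. (norm \<eta>)\<^sup>2 / 2 = 1 / 2}"
  let ?I = "moser_map c ` kepler_level c"
  have S_iff: "(\<xi>, \<eta>) \<in> S \<longleftrightarrow> (\<xi>, \<eta>) \<in> cotangent_S3 \<and> norm \<eta> = 1" for \<xi> \<eta>
    by (auto simp: S_def power2_eq_1_iff) (metis norm_ge_zero not_one_le_zero neg_0_le_iff_le)
  have "?I \<subseteq> S"
  proof (rule image_subsetI)
    fix w assume "w \<in> kepler_level c"
    moreover obtain q p where "w = (q, p)" by (cases w)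
    ultimately show "moser_map c w \<in> S"
      using stereographic_lift_in[of "(1 / sqrt (-2 * c)) *\<^sub>R p" "(2 * c) *\<^sub>R q"]
        S_iff[of "fst (moser_map c w)" "snd (moser_map c w)"]
      by (simp only: kepler_level_iff[OF c] moser_map_def prod.case prod.collapse)
  qed
  moreover have "closed S"
  proof -
    have "S = {w. norm (fst w) = 1} \<inter> {w. fst w \<bullet> snd w = 0} \<inter> {w. norm (snd w) = 1}"
      by (auto simp: S_iff cotangent_S3_def)
    moreover have "closed \<dots>"
      by (intro closed_Int closed_Collect_eq continuous_intros)
    ultimately show ?thesis by simp
  qed
  ultimately have "closure ?I \<subseteq> S" by (rule closure_minimal)
  have off_pole: "(\<xi>, \<eta>) \<in> ?I" if "(\<xi>, \<eta>) \<in> S" "\<xi>$1 \<noteq> 1" for \<xi> \<eta>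
  proof -
    obtain y x where yx: "stereographic_lift y x = (\<xi>, \<eta>)" "((norm y)\<^sup>2 + 1) * norm x = 2"
      using stereographic_lift_onto \<open>\<xi>$1 \<noteq> 1\<close> \<open>(\<xi>, \<eta>) \<in> S\<close> unfolding S_iff by metis
    define q p where "q = (1 / (2 * c)) *\<^sub>R x" and "p = sqrt (-2 * c) *\<^sub>R y"
    have eqs: "(1 / sqrt (-2 * c)) *\<^sub>R p = y" "(2 * c) *\<^sub>R q = x"
      using c by (simp_all add: q_def p_def)
    have "(q, p) \<in> kepler_level c" unfolding kepler_level_iff[OF c] eqs by (rule yx)
    moreover have "moser_map c (q, p) = (\<xi>, \<eta>)" unfolding moser_map_def prod.case eqs by (rule yx)
    ultimately show ?thesis by (metis image_eqI)
  qed
  have "S \<subseteq> closure ?I"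
  proof (rule subrelI)
    fix \<xi> \<eta> assume S: "(\<xi>, \<eta>) \<in> S"
    show "(\<xi>, \<eta>) \<in> closure ?I"
    proof (cases "\<xi>$1 = 1")
      case False
      then show ?thesis by (intro subsetD[OF closure_subset] off_pole[OF S])
    next
      case True
      have n: "\<xi> \<bullet> \<xi> = 1" "\<eta> \<bullet> \<eta> = 1" "\<xi> \<bullet> \<eta> = 0" "\<eta> \<bullet> \<xi> = 0"
        using S by (simp_all add: S_iff cotangent_S3_def norm_eq_1 inner_commute)
      have "\<xi>$2 * \<xi>$2 + \<xi>$3 * \<xi>$3 + \<xi>$4 * \<xi>$4 = 0"
        using n(1) True by (simp add: inner_vec_def sum_4)
      then have "\<xi>$2 = 0 \<and> \<xi>$3 = 0 \<and> \<xi>$4 = 0"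
        by (simp add: add_nonneg_eq_0_iff)
      then have \<eta>1: "\<eta>$1 = 0"
        using n(3) True by (simp add: inner_vec_def sum_4)
      define g where "g = (\<lambda>t::real. (cos t *\<^sub>R \<xi> + sin t *\<^sub>R \<eta>, cos t *\<^sub>R \<eta> - sin t *\<^sub>R \<xi>))"
      define u where "u = (\<lambda>n::nat. 1 / real (Suc n))"
      have "g (u n) \<in> ?I" for n
      proof -
        have "0 < u n" "u n \<le> 1" by (simp_all add: u_def)
        then have "cos (u n) < cos 0"
          using pi_gt3 by (intro cos_monotone_0_pi) auto
        then have "(fst (g (u n)))$1 \<noteq> 1" by (simp add: g_def True \<eta>1)
        moreover have "g (u n) \<in> S"
          unfolding g_def S_iff cotangent_S3_def
          by (simp add: norm_eq_1 inner_add_left inner_add_right inner_diff_left inner_diff_right n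
              flip: power2_eq_square)
        ultimately show ?thesis using off_pole[of "fst (g (u n))" "snd (g (u n))"] by simp
      qed
      moreover have "(\<lambda>n. g (u n)) \<longlonglongrightarrow> (\<xi>, \<eta>)"
      proof -
        have "u \<longlonglongrightarrow> 0" unfolding u_def using LIMSEQ_inverse_real_of_nat by (simp add: field_simps)
        moreover have "isCont g 0" unfolding g_def by (intro continuous_intros)
        ultimately have "(\<lambda>n. g (u n)) \<longlonglongrightarrow> g 0" by (rule isCont_tendsto_compose[rotated])
        then show ?thesis by (simp add: g_def)
      qed
      ultimately show ?thesis
        unfolding closure_sequential by (intro exI[of _ "\<lambda>n. g (u n)"]) simp
    qed
  qed
  with \<open>closure ?I \<subseteq> S\<close> show ?thesis by (simp add: moser_regularization_def S_def)
qed

end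

theory Submission
  imports Defs
begin

text \<open>The regularized level set is the unit cotangent bundle, to which the fibrewise Euler field
  \<open>(0, \<eta>)\<close>, a Liouville field of \<open>\<omega>\<^sub>s\<^sub>t\<^sub>d\<close>, is transverse. For the metric induced from
  \<open>\<real>\<^sup>4 \<times> \<real>\<^sup>4\<close> the Hessian of \<open>H = (\<parallel>\<eta>\<parallel>\<^sup>2 - 1) / 2\<close> is only semidefinite: it is \<open>\<parallel>X\<^sub>\<eta>\<parallel>\<^sup>2\<close>. A conformal
  change by \<open>exp (2 f)\<close> adds \<open>\<langle>grad f, grad H\<rangle> \<parallel>X\<parallel>\<^sup>2\<close> for \<open>X\<close> tangent to the level set, so \<open>f = \<parallel>\<eta>\<parallel>\<^sup>2 / 2\<close>
  makes it \<open>\<parallel>X\<^sub>\<eta>\<parallel>\<^sup>2 + \<parallel>X\<parallel>\<^sup>2\<close>.\<close>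

section \<open>Calculus of smooth maps\<close>

lemma Ck_on_cong:
  assumes "open U" "\<And>x. x \<in> U \<Longrightarrow> f x = g x" "Ck_on k U f"
  shows "Ck_on k U g"
  using assms(2,3)
proof (induction k arbitrary: f g)
  case 0
  then show ?case by (auto cong: continuous_on_cong)
next
  case (Suc k)
  have *: "(f has_derivative D) (at x) \<longleftrightarrow> (g has_derivative D) (at x)" if "x \<in> U" for x D
    using has_derivative_transform_within_open[of f D x UNIV U g]
      has_derivative_transform_within_open[of g D x UNIV U f] \<open>open U\<close> that Suc.prems(1) by auto
  have "g differentiable (at x)" if "x \<in> U" for x
    using Suc.prems(2) * that unfolding differentiable_def Ck_on.simps by blast
  moreover have "frechet_derivative f (at x) = frechet_derivative g (at x)" if "x \<in> U" for x
    unfolding frechet_derivative_def by (simp only: *[OF that])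
  then have "Ck_on k U (\<lambda>x. frechet_derivative g (at x) v)" for v
    using Suc.prems(2) Suc.IH[of "\<lambda>x. frechet_derivative f (at x) v"
        "\<lambda>x. frechet_derivative g (at x) v"] by simp
  ultimately show ?case unfolding Ck_on.simps by blast
qed

text \<open>\<open>Ck_on\<close> speaks of the chosen \<open>frechet_derivative\<close>; since
  derivatives at a point are unique, any explicit family \<open>D\<close> may take its place. The
  inductions on \<open>k\<close> below pass through this rule.\<close>

lemma Ck_on_SucI:
  assumes "open U" "\<And>x. x \<in> U \<Longrightarrow> (f has_derivative D x) (at x)" "\<And>v. Ck_on k U (\<lambda>x. D x v)"
  shows "Ck_on (Suc k) U f"
proof -
  have "Ck_on k U (\<lambda>x. frechet_derivative f (at x) v)" for v
    by (rule Ck_on_cong[OF assms(1) _ assms(3)[of v]]) (simp flip: frechet_derivative_at[OF assms(2)])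
  then show ?thesis using assms(2) by (auto simp: differentiable_def)
qed

lemma Ck_on_has_derivative:
  "Ck_on (Suc k) U f \<Longrightarrow> x \<in> U \<Longrightarrow> (f has_derivative frechet_derivative f (at x)) (at x)"
  by (simp add: frechet_derivative_works[symmetric])

lemma Ck_on_SucD: "Ck_on (Suc k) U f \<Longrightarrow> Ck_on k U f"
proof (induction k arbitrary: f)
  case 0
  then show ?case
    by (auto intro!: differentiable_imp_continuous_within continuous_at_imp_continuous_on)
next
  case (Suc k)
  then show ?case by (metis Ck_on.simps(2))
qed

lemma Ck_on_subset: "Ck_on k U f \<Longrightarrow> V \<subseteq> U \<Longrightarrow> Ck_on k V f"
  by (induction k arbitrary: f) (auto intro: continuous_on_subset)

lemma Ck_on_const: "open U \<Longrightarrow> Ck_on k U (\<lambda>x. c)"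
proof (induction k arbitrary: c)
  case (Suc k)
  show ?case by (rule Ck_on_SucI[where D = "\<lambda>x v. 0"]) (use Suc in auto)
qed simp

lemma Ck_on_linear: "open U \<Longrightarrow> bounded_linear f \<Longrightarrow> Ck_on k U f"
proof (cases k)
  case (Suc m)
  assume "open U" "bounded_linear f"
  then show ?thesis unfolding Suc
    by (intro Ck_on_SucI[where D = "\<lambda>x. f"] Ck_on_const bounded_linear_imp_has_derivative)
qed (simp add: linear_continuous_on)

lemma Ck_on_add: "open U \<Longrightarrow> Ck_on k U f \<Longrightarrow> Ck_on k U g \<Longrightarrow> Ck_on k U (\<lambda>x. f x + g x)"
proof (induction k arbitrary: f g)
  case 0
  then show ?case by (auto intro: continuous_on_add)
next
  case (Suc k)
  show ?case
    by (rule Ck_on_SucI[OF \<open>open U\<close> has_derivative_add[OF Ck_on_has_derivative[OF Suc.prems(2)]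
            Ck_on_has_derivative[OF Suc.prems(3)]]])
      (use Suc in auto)
qed

lemma Ck_on_sum:
  "open U \<Longrightarrow> (\<And>i. i \<in> I \<Longrightarrow> Ck_on k U (f i)) \<Longrightarrow> Ck_on k U (\<lambda>x. \<Sum>i\<in>I. f i x)"
  by (induction I rule: infinite_finite_induct) (auto intro: Ck_on_add Ck_on_const)

text \<open>The Leibniz rule turns the derivative into a sum of two products of the same kind, so
  the induction runs over all pairs \<open>f\<close>, \<open>g\<close> at once.\<close>

lemma Ck_on_bilinear:
  assumes "bounded_bilinear pr" "open U"
  shows "Ck_on k U f \<Longrightarrow> Ck_on k U g \<Longrightarrow> Ck_on k U (\<lambda>x. pr (f x) (g x))"
proof (induction k arbitrary: f g)
  case 0
  then show ?case by (auto intro: bounded_bilinear.continuous_on[OF assms(1)])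
next
  case (Suc k)
  note f = Suc.prems(1) and g = Suc.prems(2)
  show ?case
  proof (rule Ck_on_SucI[OF \<open>open U\<close> bounded_bilinear.FDERIV[OF assms(1)
            Ck_on_has_derivative[OF f] Ck_on_has_derivative[OF g]]])
    fix v
    have "Ck_on k U (\<lambda>x. frechet_derivative f (at x) v)" "Ck_on k U (\<lambda>x. frechet_derivative g (at x) v)"
      using f g by auto
    then show "Ck_on k U (\<lambda>x. pr (f x) (frechet_derivative g (at x) v)
        + pr (frechet_derivative f (at x) v) (g x))"
      by (intro Ck_on_add[OF \<open>open U\<close>] Suc.IH Ck_on_SucD[OF f] Ck_on_SucD[OF g])
  qed
qed

text \<open>Lets a derivative be applied to a direction that varies with the base point:
  \<open>Ck_on\<close> controls fixed directions only, and the basis expansion reduces to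
  these.\<close>

lemma linear_euclidean_expansion:
  assumes "linear f" shows "f v = (\<Sum>b\<in>Basis. (v \<bullet> b) *\<^sub>R f b)"
proof -
  have "f v = f (\<Sum>b\<in>Basis. (v \<bullet> b) *\<^sub>R b)" by (simp add: euclidean_representation)
  also have "\<dots> = (\<Sum>b\<in>Basis. (v \<bullet> b) *\<^sub>R f b)"
    by (simp add: linear_sum[OF assms] linear_scale[OF assms])
  finally show ?thesis .
qed

lemma Ck_on_compose:
  assumes "open U" "open V" "g ` U \<subseteq> V"
  shows "Ck_on k V f \<Longrightarrow> Ck_on k U g \<Longrightarrow> Ck_on k U (\<lambda>x. f (g x))"
proof (induction k arbitrary: f)
  case 0
  then show ?case using assms(3) by (auto intro: continuous_on_compose2)
next
  case (Suc k)
  note f = Suc.prems(1) and g = Suc.prems(2)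
  \<comment> \<open>The chain rule applies Df at \<open>g x\<close> to a direction that moves with
    x. Expanded in the basis it is a sum of products whose second factors, derivatives of
    \<open>f\<close> in fixed directions composed with \<open>g\<close>, fall under the induction
    hypothesis.\<close>
  define D where "D = (\<lambda>x v. \<Sum>b\<in>Basis. (frechet_derivative g (at x) v \<bullet> b) *\<^sub>R
    frechet_derivative f (at (g x)) b)"
  show ?case
  proof (rule Ck_on_SucI[OF \<open>open U\<close>])
    fix x assume x: "x \<in> U"
    have fg: "(f has_derivative frechet_derivative f (at (g x))) (at (g x))"
      using Ck_on_has_derivative[OF f] assms(3) x by auto
    show "((\<lambda>x. f (g x)) has_derivative D x) (at x)"
      using has_derivative_compose[OF Ck_on_has_derivative[OF g x] fg]
      unfolding D_def linear_euclidean_expansion[OF has_derivative_linear[OF fg], symmetric] .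
  next
    fix v
    have "Ck_on k U (\<lambda>x. frechet_derivative g (at x) v)"
      "\<And>b. Ck_on k V (\<lambda>x. frechet_derivative f (at x) b)"
      using f g by auto
    then show "Ck_on k U (\<lambda>x. D x v)"
      unfolding D_def
      by (intro Ck_on_sum[OF \<open>open U\<close>] Ck_on_bilinear[OF bounded_bilinear_scaleR \<open>open U\<close>]
          Ck_on_bilinear[OF bounded_bilinear_inner \<open>open U\<close>] Ck_on_const[OF \<open>open U\<close>]
          Suc.IH Ck_on_SucD[OF g])
  qed
qed

text \<open>The derivative is built from \<open>inverse\<close> itself by products with constants,
  so each order of differentiability yields the next.\<close>

lemma Ck_on_inverse: "Ck_on k {x::real. x \<noteq> 0} inverse"
proof (induction k)
  case 0
  then show ?case by (auto intro!: continuous_intros)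
next
  case (Suc k)
  have o: "open {x::real. x \<noteq> 0}" by (intro open_Collect_neq continuous_intros)
  show ?case
  proof (rule Ck_on_SucI[OF o])
    show "(inverse has_derivative (\<lambda>v. (inverse x * inverse x) * (- v))) (at x)" if "x \<in> {x. x \<noteq> 0}" for x :: real
      using that by (auto intro!: derivative_eq_intros)
    show "Ck_on k {x. x \<noteq> 0} (\<lambda>x::real. (inverse x * inverse x) * (- v))" for v
      by (intro Ck_on_bilinear[OF bounded_bilinear_mult o] Suc Ck_on_const[OF o])
  qed
qed

lemma Ck_on_sqrt: "Ck_on k {x. 0 < x} sqrt"
proof (induction k)
  case 0
  then show ?case by (auto intro!: continuous_intros)
next
  case (Suc k)
  have o: "open {x::real. 0 < x}" by (intro open_Collect_less continuous_intros)
  \<comment> \<open>The derivative of \<open>sqrt\<close> is a multiple of this function, which is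
    the induction hypothesis followed by \<open>inverse\<close>.\<close>
  have "Ck_on k {x. 0 < x} (\<lambda>x. inverse (sqrt x))"
    by (rule Ck_on_compose[OF o _ _ Ck_on_inverse Suc])
      (auto intro!: open_Collect_neq continuous_intros)
  then have "Ck_on k {x. 0 < x} (\<lambda>x. inverse (sqrt x) * (v / 2))" for v
    by (intro Ck_on_bilinear[OF bounded_bilinear_mult o] Ck_on_const[OF o])
  then show ?case
    by (intro Ck_on_SucI[OF o, where D = "\<lambda>x v. inverse (sqrt x) * (v / 2)"])
      (auto intro!: derivative_eq_intros simp: field_simps)
qed

lemma Ck_on_exp: "Ck_on k UNIV (exp :: real \<Rightarrow> real)"
proof (induction k)
  case 0
  then show ?case by (auto intro!: continuous_intros)
next
  case (Suc k)
  show ?case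
    by (rule Ck_on_SucI[where D = "\<lambda>x v. exp x * v"])
      (auto intro!: derivative_eq_intros Ck_on_bilinear[OF bounded_bilinear_mult] Suc Ck_on_const)
qed

section \<open>Smooth maps on arbitrary subsets\<close>

lemma smooth_mapI_Ck_on: "open U \<Longrightarrow> (\<And>k. Ck_on k U f) \<Longrightarrow> smooth_map U f"
  unfolding smooth_map_def by blast

text \<open>Smoothness is a local property; this serves where a manifestly smooth formula exists
  only near each point, as in \<open>smooth_map_dird\<close>.\<close>

lemma smooth_map_local:
  assumes "\<And>x. x \<in> W \<Longrightarrow> \<exists>U g. open U \<and> x \<in> U \<and> smooth_map (U \<inter> W) g \<and> (\<forall>y\<in>U \<inter> W. g y = f y)"
  shows "smooth_map W f"
  unfolding smooth_map_def
proof
  fix x assume "x \<in> W"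
  then obtain U g where U: "open U" "x \<in> U" "smooth_map (U \<inter> W) g" "\<forall>y\<in>U \<inter> W. g y = f y"
    using assms by blast
  moreover have "x \<in> U \<inter> W" using U \<open>x \<in> W\<close> by simp
  ultimately obtain V F where "open V" "x \<in> V" "\<forall>k. Ck_on k V F" "\<forall>y\<in>V \<inter> (U \<inter> W). F y = g y"
    unfolding smooth_map_def by meson
  then show "\<exists>U F. open U \<and> x \<in> U \<and> (\<forall>k. Ck_on k U F) \<and> (\<forall>y\<in>U \<inter> W. F y = f y)"
    using U by (intro exI[of _ "V \<inter> U"] exI[of _ F]) (auto intro: Ck_on_subset)
qed

lemma smooth_map_subset:
  assumes "smooth_map W f" "V \<subseteq> W" shows "smooth_map V f"
  unfolding smooth_map_def
proof
  fix x assume "x \<in> V"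
  with assms(2) have "x \<in> W" by blast
  then obtain U F where "open U" "x \<in> U" "\<forall>k. Ck_on k U F" "\<forall>y\<in>U \<inter> W. F y = f y"
    using assms(1) unfolding smooth_map_def by blast
  then show "\<exists>U F. open U \<and> x \<in> U \<and> (\<forall>k. Ck_on k U F) \<and> (\<forall>y\<in>U \<inter> V. F y = f y)"
    using assms(2) by (intro exI[of _ U] exI[of _ F]) auto
qed

lemma smooth_map_cong:
  assumes "smooth_map W f" "\<And>x. x \<in> W \<Longrightarrow> f x = g x" shows "smooth_map W g"
  using assms(1) unfolding smooth_map_def by (simp add: assms(2))

lemma smooth_map_Ck_map:
  assumes "smooth_map W f" shows "Ck_map k W f"
  unfolding Ck_map_def
proof
  fix x assume "x \<in> W"
  then obtain U F where "open U" "x \<in> U" "\<forall>k. Ck_on k U F" "\<forall>y\<in>U \<inter> W. F y = f y"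
    using assms unfolding smooth_map_def by blast
  then show "\<exists>U F. open U \<and> x \<in> U \<and> Ck_on k U F \<and> (\<forall>y\<in>U \<inter> W. F y = f y)"
    by (intro exI[of _ U] exI[of _ F]) simp
qed

named_theorems smooth_intros

lemma smooth_map_linear: "bounded_linear f \<Longrightarrow> smooth_map W f"
  by (rule smooth_map_subset[OF smooth_mapI_Ck_on[of UNIV]]) (auto intro: Ck_on_linear)

lemma smooth_map_const [smooth_intros]: "smooth_map W (\<lambda>x. c)"
  by (rule smooth_map_subset[OF smooth_mapI_Ck_on[of UNIV]]) (auto intro: Ck_on_const)

lemma smooth_map_id [smooth_intros]: "smooth_map W (\<lambda>x. x)"
  by (intro smooth_map_linear bounded_linear_ident)

lemma smooth_map_compose:
  assumes g: "smooth_map B g" and f: "smooth_map A f" and "f ` A \<subseteq> B"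
  shows "smooth_map A (\<lambda>x. g (f x))"
  unfolding smooth_map_def
proof
  fix x assume x: "x \<in> A"
  then obtain U F where F: "open U" "x \<in> U" "\<forall>k. Ck_on k U F" "\<forall>y\<in>U \<inter> A. F y = f y"
    using f unfolding smooth_map_def by blast
  obtain V G where G: "open V" "f x \<in> V" "\<forall>k. Ck_on k V G" "\<forall>y\<in>V \<inter> B. G y = g y"
    using g imageI[OF x, of f, THEN subsetD[OF assms(3)]] unfolding smooth_map_def by blast
  \<comment> \<open>The extension \<open>F\<close> may leave \<open>B\<close> and even the domain
    \<open>V\<close> of \<open>G\<close>, so it is restricted to the points that it sends into
    \<open>V\<close>; these form an open set by continuity.\<close>
  define T where "T = U \<inter> F -` V"
  have "continuous_on U F" using F(3) by (metis Ck_on.simps(1))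
  then have T: "open T" unfolding T_def using F(1) G(1) by (simp add: continuous_on_open_vimage Int_commute)
  have "Ck_on k T (\<lambda>x. G (F x))" for k
    by (rule Ck_on_compose[OF T G(1)]) (use F G in \<open>auto simp: T_def intro: Ck_on_subset\<close>)
  then show "\<exists>U F. open U \<and> x \<in> U \<and> (\<forall>k. Ck_on k U F) \<and> (\<forall>y\<in>U \<inter> A. F y = g (f y))"
    using T F G x assms(3)
    by (intro exI[of _ T] exI[of _ "\<lambda>x. G (F x)"]) (auto simp: T_def image_subset_iff)
qed

lemma smooth_map_compose_linear:
  "bounded_linear g \<Longrightarrow> smooth_map A f \<Longrightarrow> smooth_map A (\<lambda>x. g (f x))"
  by (rule smooth_map_compose[OF smooth_map_linear[of _ UNIV]]) auto

text \<open>Two local extensions share the intersection of their domains, so an operation that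
  preserves class C^k on open sets preserves smoothness on any \<open>W\<close>.\<close>

lemma smooth_map_combine:
  fixes f :: "'a::euclidean_space \<Rightarrow> 'b::euclidean_space" and g :: "'a \<Rightarrow> 'c::euclidean_space"
  assumes f: "smooth_map W f" and g: "smooth_map W g"
    and op: "\<And>k (U :: 'a set) F G. open U \<Longrightarrow> Ck_on k U F \<Longrightarrow> Ck_on k U G \<Longrightarrow> Ck_on k U (\<lambda>x. op (F x) (G x))"
  shows "smooth_map W (\<lambda>x. op (f x) (g x))"
  unfolding smooth_map_def
proof
  fix x assume x: "x \<in> W"
  then obtain U F where F: "open U" "x \<in> U" "\<forall>k. Ck_on k U F" "\<forall>y\<in>U \<inter> W. F y = f y"
    using f unfolding smooth_map_def by blast
  obtain V G where G: "open V" "x \<in> V" "\<forall>k. Ck_on k V G" "\<forall>y\<in>V \<inter> W. G y = g y"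
    using g x unfolding smooth_map_def by blast
  have "Ck_on k (U \<inter> V) (\<lambda>x. op (F x) (G x))" for k
    by (rule op[OF open_Int[OF F(1) G(1)] Ck_on_subset[OF F(3)[rule_format]] Ck_on_subset[OF G(3)[rule_format]]]) auto
  then show "\<exists>U F. open U \<and> x \<in> U \<and> (\<forall>k. Ck_on k U F) \<and> (\<forall>y\<in>U \<inter> W. F y = op (f y) (g y))"
    using F G by (intro exI[of _ "U \<inter> V"] exI[of _ "\<lambda>x. op (F x) (G x)"]) auto
qed

lemma smooth_map_bilinear:
  "bounded_bilinear pr \<Longrightarrow> smooth_map W f \<Longrightarrow> smooth_map W g \<Longrightarrow> smooth_map W (\<lambda>x. pr (f x) (g x))"
  by (rule smooth_map_combine) (auto intro: Ck_on_bilinear)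

lemma smooth_map_add [smooth_intros]:
  "smooth_map W f \<Longrightarrow> smooth_map W g \<Longrightarrow> smooth_map W (\<lambda>x. f x + g x)"
  by (rule smooth_map_combine) (auto intro: Ck_on_add)

lemma smooth_map_sum [smooth_intros]:
  "(\<And>i. i \<in> I \<Longrightarrow> smooth_map W (f i)) \<Longrightarrow> smooth_map W (\<lambda>x. \<Sum>i\<in>I. f i x)"
  by (induction I rule: infinite_finite_induct) (simp_all add: smooth_map_const smooth_map_add)

lemmas smooth_map_inner [smooth_intros] = smooth_map_bilinear[OF bounded_bilinear_inner]
  and smooth_map_scaleR [smooth_intros] = smooth_map_bilinear[OF bounded_bilinear_scaleR]
  and smooth_map_mult [smooth_intros] = smooth_map_bilinear[OF bounded_bilinear_mult]
  and smooth_map_minus [smooth_intros] = smooth_map_compose_linear[OF bounded_linear_minus[OF bounded_linear_ident]]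
  and smooth_map_fst [smooth_intros] = smooth_map_compose_linear[OF bounded_linear_fst]
  and smooth_map_snd [smooth_intros] = smooth_map_compose_linear[OF bounded_linear_snd]

lemma smooth_map_diff [smooth_intros]:
  fixes f g :: "'a::euclidean_space \<Rightarrow> 'b::euclidean_space"
  shows "smooth_map W f \<Longrightarrow> smooth_map W g \<Longrightarrow> smooth_map W (\<lambda>x. f x - g x)"
  using smooth_map_add[OF _ smooth_map_minus, of W f g] by simp

lemma smooth_map_Pair [smooth_intros]:
  fixes f :: "'a::euclidean_space \<Rightarrow> 'b::euclidean_space" and g :: "'a \<Rightarrow> 'c::euclidean_space"
  assumes "smooth_map W f" "smooth_map W g"
  shows "smooth_map W (\<lambda>x. (f x, g x))"
proof -
  have "bounded_linear (\<lambda>y::'b. (y, 0::'c))" "bounded_linear (\<lambda>z::'c. (0::'b, z))"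
    by (intro bounded_linear_Pair bounded_linear_ident bounded_linear_zero)+
  from smooth_map_add[OF smooth_map_compose_linear[OF this(1) assms(1)]
      smooth_map_compose_linear[OF this(2) assms(2)]]
  show ?thesis by simp
qed

lemma smooth_map_exp [smooth_intros]:
  fixes f :: "'a::euclidean_space \<Rightarrow> real"
  shows "smooth_map W f \<Longrightarrow> smooth_map W (\<lambda>x. exp (f x))"
  by (rule smooth_map_compose[OF smooth_mapI_Ck_on[OF _ Ck_on_exp]]) auto

lemma smooth_map_inverse [smooth_intros]:
  fixes f :: "'a::euclidean_space \<Rightarrow> real"
  shows "smooth_map W f \<Longrightarrow> (\<And>x. x \<in> W \<Longrightarrow> f x \<noteq> 0) \<Longrightarrow> smooth_map W (\<lambda>x. inverse (f x))"
  by (rule smooth_map_compose[OF smooth_mapI_Ck_on[OF _ Ck_on_inverse]])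
    (auto intro!: open_Collect_neq continuous_intros)

lemma smooth_map_divide [smooth_intros]:
  fixes f g :: "'a::euclidean_space \<Rightarrow> real"
  shows "smooth_map W f \<Longrightarrow> smooth_map W g \<Longrightarrow> (\<And>x. x \<in> W \<Longrightarrow> g x \<noteq> 0) \<Longrightarrow> smooth_map W (\<lambda>x. f x / g x)"
  unfolding divide_inverse by (intro smooth_intros)

lemma smooth_map_sqrt [smooth_intros]:
  fixes f :: "'a::euclidean_space \<Rightarrow> real"
  shows "smooth_map W f \<Longrightarrow> (\<And>x. x \<in> W \<Longrightarrow> 0 < f x) \<Longrightarrow> smooth_map W (\<lambda>x. sqrt (f x))"
  by (rule smooth_map_compose[OF smooth_mapI_Ck_on[OF _ Ck_on_sqrt]])
    (auto intro!: open_Collect_less continuous_intros)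

lemma smooth_map_norm [smooth_intros]:
  fixes f :: "'a::euclidean_space \<Rightarrow> 'b::euclidean_space"
  shows "smooth_map W f \<Longrightarrow> (\<And>x. x \<in> W \<Longrightarrow> f x \<noteq> 0) \<Longrightarrow> smooth_map W (\<lambda>x. norm (f x))"
  unfolding norm_eq_sqrt_inner by (intro smooth_intros) auto

section \<open>Derivatives along tangent vectors\<close>

lemma smooth_map_has_derivative:
  assumes "smooth_map W f" "x \<in> W"
  shows "(f has_derivative frechet_derivative f (at x within W)) (at x within W)"
proof -
  obtain U F where F: "open U" "x \<in> U" "\<forall>k. Ck_on k U F" "\<forall>y\<in>U \<inter> W. F y = f y"
    using assms unfolding smooth_map_def by blast
  have "(F has_derivative frechet_derivative F (at x)) (at x within W)"
    by (rule has_derivative_at_withinI[OF Ck_on_has_derivative[OF F(3)[rule_format, of "Suc 0"] F(2)]])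
  moreover obtain d where "d > 0" "ball x d \<subseteq> U" using F(1,2) by (meson openE)
  ultimately have "(f has_derivative frechet_derivative F (at x)) (at x within W)"
    using F(4) assms(2)
    by (intro has_derivative_transform_within[of F _ x W d f]) (auto simp: subset_iff dist_commute)
  then show ?thesis by (metis differentiable_def frechet_derivative_works)
qed

text \<open>Composing with a curve in \<open>W\<close> of velocity \<open>v\<close> leaves a
  function of one real variable, whose derivative at the interior point 0 is unique. Hence
  \<open>dird\<close> on tangent fields does not depend on the choice that
  \<open>frechet_derivative\<close> makes within a thin set \<open>W\<close>.\<close>

lemma has_derivative_unique_tangent:
  assumes v: "v \<in> tangent_space W x"
    and D: "(f has_derivative D) (at x within W)" "(f has_derivative D') (at x within W)"
  shows "D v = D' v"
proof -
  obtain e \<gamma> where e: "e > 0" and \<gamma>: "\<gamma> ` {-e<..<e::real} \<subseteq> W" "\<gamma> 0 = x"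
      "(\<gamma> has_vector_derivative v) (at 0)"
    using v unfolding tangent_space_def by blast
  let ?I = "{-e<..<e}"
  have \<gamma>': "(\<gamma> has_derivative (\<lambda>t. t *\<^sub>R v)) (at 0 within ?I)"
    using \<gamma>(3) unfolding has_vector_derivative_def by (rule has_derivative_at_withinI)
  have *: "((\<lambda>t. f (\<gamma> t)) has_derivative (\<lambda>t. E (t *\<^sub>R v))) (at 0)"
    if "(f has_derivative E) (at x within W)" for E
  proof -
    have "((\<lambda>t. f (\<gamma> t)) has_derivative (\<lambda>t. E (t *\<^sub>R v))) (at 0 within ?I)"
      using has_derivative_in_compose[OF \<gamma>', of f E] that \<gamma>(1,2)
      by (auto intro: has_derivative_subset)
    then show ?thesis using e by (simp add: at_within_open[of 0 ?I])
  qed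
  have "(\<lambda>t. D (t *\<^sub>R v)) = (\<lambda>t. D' (t *\<^sub>R v))" using *[OF D(1)] *[OF D(2)] has_derivative_unique by blast
  from fun_cong[OF this, of 1] show ?thesis by simp
qed

lemma dird_eq:
  assumes "X x \<in> tangent_space W x" "(f has_derivative D) (at x within W)"
  shows "dird W X f x = D (X x)"
proof -
  have "(f has_derivative frechet_derivative f (at x within W)) (at x within W)"
    using assms(2) by (metis differentiable_def frechet_derivative_works)
  then show ?thesis unfolding dird_def using has_derivative_unique_tangent assms by metis
qed

lemma vector_fieldD:
  assumes "vector_field W X"
  shows "smooth_map W X" "x \<in> W \<Longrightarrow> X x \<in> tangent_space W x"
  using assms by (auto simp: vector_field_def)

lemma dird_bilinear:
  assumes "bounded_bilinear pr" "X x \<in> tangent_space W x" "x \<in> W" "smooth_map W f" "smooth_map W g"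
  shows "dird W X (\<lambda>z. pr (f z) (g z)) x = pr (f x) (dird W X g x) + pr (dird W X f x) (g x)"
  using dird_eq[of X, OF assms(2) bounded_bilinear.FDERIV[OF assms(1) smooth_map_has_derivative[OF assms(4,3)]
    smooth_map_has_derivative[OF assms(5,3)]]] by (simp add: dird_def)

lemma dird_add:
  assumes "X x \<in> tangent_space W x" "x \<in> W" "smooth_map W f" "smooth_map W g"
  shows "dird W X (\<lambda>z. f z + g z) x = dird W X f x + dird W X g x"
  using dird_eq[of X, OF assms(1) has_derivative_add[OF smooth_map_has_derivative[OF assms(3,2)]
    smooth_map_has_derivative[OF assms(4,2)]]] by (simp add: dird_def)

lemma dird_linear:
  assumes "bounded_linear h" "X x \<in> tangent_space W x" "x \<in> W" "smooth_map W f"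
  shows "dird W X (\<lambda>z. h (f z)) x = h (dird W X f x)"
  using dird_eq[of X, OF assms(2) bounded_linear.has_derivative[OF assms(1) smooth_map_has_derivative[OF assms(4,3)]]]
  by (simp add: dird_def)

lemma dird_id:
  assumes "X x \<in> tangent_space W x"
  shows "dird W X (\<lambda>z. z) x = X x"
  by (rule dird_eq[of X, OF assms has_derivative_ident])

lemma dird_const:
  assumes "X x \<in> tangent_space W x"
  shows "dird W X (\<lambda>z. c) x = 0"
  by (rule dird_eq[of X, OF assms has_derivative_const])

lemma dird_cong:
  assumes "X x \<in> tangent_space W x" "x \<in> W" "smooth_map W f" "\<And>z. z \<in> W \<Longrightarrow> g z = f z"
  shows "dird W X g x = dird W X f x"
proof -
  have "(g has_derivative frechet_derivative f (at x within W)) (at x within W)"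
    using has_derivative_transform[OF assms(2) assms(4) smooth_map_has_derivative[OF assms(3,2)]] .
  from dird_eq[of X, OF assms(1) this] show ?thesis by (simp add: dird_def)
qed

lemma dird_field_linear:
  assumes "smooth_map W f" "x \<in> W"
  shows "dird W (\<lambda>z. X z + Y z) f x = dird W X f x + dird W Y f x"
    and "dird W (\<lambda>z. c z *\<^sub>R X z) f x = c x *\<^sub>R dird W X f x"
  using has_derivative_linear[OF smooth_map_has_derivative[OF assms]]
  by (simp_all add: dird_def linear_add linear_scale)

lemma smooth_map_dird:
  assumes X: "vector_field W X" and f: "smooth_map W f"
  shows "smooth_map W (dird W X f)"
proof (rule smooth_map_local)
  fix x assume x: "x \<in> W"
  obtain U F where F: "open U" "x \<in> U" "\<forall>k. Ck_on k U F" "\<forall>y\<in>U \<inter> W. F y = f y"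
    using f x unfolding smooth_map_def by blast
  \<comment> \<open>The derivative of the local extension along \<open>X\<close>; the basis
    expansion makes its smoothness visible. It equals \<open>dird W X f\<close> on \<open>W\<close>
    because \<open>X\<close> is tangent there.\<close>
  define g where "g = (\<lambda>y. \<Sum>b\<in>Basis. (X y \<bullet> b) *\<^sub>R frechet_derivative F (at y) b)"
  have "smooth_map U (\<lambda>y. frechet_derivative F (at y) b)" for b
    using F(1) F(3)[rule_format, of "Suc _"] by (intro smooth_mapI_Ck_on) auto
  then have "smooth_map (U \<inter> W) g" unfolding g_def
    using vector_fieldD(1)[OF X] by (intro smooth_intros) (auto intro: smooth_map_subset)
  moreover have "g y = dird W X f y" if y: "y \<in> U \<inter> W" for y
  proof -
    have D: "(F has_derivative frechet_derivative F (at y)) (at y)"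
      using y by (intro Ck_on_has_derivative[OF F(3)[rule_format, of "Suc 0"]]) simp
    obtain d where "d > 0" "ball y d \<subseteq> U" using F(1) y by (meson IntD1 openE)
    then have "(f has_derivative frechet_derivative F (at y)) (at y within W)"
      using F(4) y D[THEN has_derivative_at_withinI]
      by (intro has_derivative_transform_within[of F _ y W d f]) (auto simp: subset_iff dist_commute)
    then have "dird W X f y = frechet_derivative F (at y) (X y)"
      using vector_fieldD(2)[OF X] y by (intro dird_eq) auto
    then show ?thesis
      unfolding g_def linear_euclidean_expansion[OF has_derivative_linear[OF D], symmetric] by simp
  qed
  ultimately show "\<exists>U g. open U \<and> x \<in> U \<and> smooth_map (U \<inter> W) g \<and> (\<forall>y\<in>U \<inter> W. g y = dird W X f y)"
    using F by blast
qed

text \<open>Being constant on \<open>W\<close>, the function also has derivative 0 within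
  \<open>W\<close>, and two such derivatives agree on tangent vectors.\<close>

lemma tangent_space_level:
  assumes v: "v \<in> tangent_space W x" and f: "\<And>y. y \<in> W \<Longrightarrow> f y = c" and D: "(f has_derivative D) (at x)"
    and x: "x \<in> W"
  shows "D v = 0"
proof -
  have "(f has_derivative (\<lambda>_. 0)) (at x within W)"
    by (rule has_derivative_transform[OF x f has_derivative_const])
  from has_derivative_unique_tangent[OF v has_derivative_at_withinI[OF D] this] show ?thesis .
qed

section \<open>The cotangent bundle of the 3-sphere\<close>

lemma cotangent_S3_iff: "z \<in> cotangent_S3 \<longleftrightarrow> fst z \<bullet> fst z = 1 \<and> fst z \<bullet> snd z = 0"
  by (auto simp: cotangent_S3_def norm_eq_1 split: prod.splits)

definition unit_cotangent_S3 :: "((real^4) \<times> (real^4)) set" where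
  "unit_cotangent_S3 = {z \<in> cotangent_S3. snd z \<bullet> snd z = 1}"

text \<open>The regularized level set is the same for every negative energy, so the geometry below
  is free of \<open>c\<close>.\<close>

lemma moser_regularization_unit_cotangent:
  "c < 0 \<Longrightarrow> moser_regularization c = unit_cotangent_S3"
  by (auto simp: moser_regularization_eq unit_cotangent_S3_def power2_norm_eq_inner)

text \<open>Differentiating the two defining equations gives one inclusion; for the other, an
  explicit curve realises each solution of the linearised equations.\<close>

lemma tangent_space_cotangent_S3:
  assumes z: "z \<in> cotangent_S3"
  shows "tangent_space cotangent_S3 z = {v. fst z \<bullet> fst v = 0 \<and> snd z \<bullet> fst v + fst z \<bullet> snd v = 0}"
proof (intro set_eqI iffI CollectI conjI)
  fix v assume v: "v \<in> tangent_space cotangent_S3 z"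
  have "2 * (fst z \<bullet> fst v) = 0"
    by (rule tangent_space_level[OF v _ _ z, where f = "\<lambda>y. fst y \<bullet> fst y"])
      (auto simp: cotangent_S3_iff inner_commute intro!: derivative_eq_intros)
  then show "fst z \<bullet> fst v = 0" by simp
  show "snd z \<bullet> fst v + fst z \<bullet> snd v = 0"
    by (rule tangent_space_level[OF v _ _ z, where f = "\<lambda>y. fst y \<bullet> snd y"])
      (auto simp: cotangent_S3_iff inner_commute intro!: derivative_eq_intros)
next
  fix v assume "v \<in> {v. fst z \<bullet> fst v = 0 \<and> snd z \<bullet> fst v + fst z \<bullet> snd v = 0}"
  then obtain \<xi> \<eta> a b where zv: "z = (\<xi>, \<eta>)" "v = (a, b)"
    and *: "\<xi> \<bullet> \<xi> = 1" "\<xi> \<bullet> \<eta> = 0" "\<eta> \<bullet> \<xi> = 0" "\<xi> \<bullet> a = 0" "a \<bullet> \<xi> = 0"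
    and b: "\<xi> \<bullet> b = - (\<eta> \<bullet> a)" "b \<bullet> \<xi> = - (\<eta> \<bullet> a)" "a \<bullet> \<eta> = \<eta> \<bullet> a"
    using z by (cases z, cases v) (auto simp: cotangent_S3_iff inner_commute)
  define s where "s = (\<lambda>t::real. 1 + t * t * (a \<bullet> a))"
  \<comment> \<open>The straight line is pushed back to the bundle. By tangency \<open>s t\<close>
    is the squared norm of \<open>\<xi> + t *\<^sub>R a\<close>, and the product of this vector with
    \<open>\<eta> + t *\<^sub>R b\<close> is \<open>t * t * (a \<bullet> b)\<close>; so the first
    component is normalised and the second loses its part along the first. Both corrections are of
    second order at 0 and leave the velocity \<open>(a, b)\<close> unchanged.\<close>
  define \<gamma> where "\<gamma> = (\<lambda>t. (inverse (sqrt (s t)) *\<^sub>R (\<xi> + t *\<^sub>R a),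
    \<eta> + t *\<^sub>R b - (t * t * (a \<bullet> b) * inverse (s t)) *\<^sub>R (\<xi> + t *\<^sub>R a)))"
  have s: "s t > 0" for t by (simp add: s_def add_pos_nonneg)
  then have s0: "s t \<noteq> 0" for t by (metis less_irrefl)
  have smooth: "smooth_map {-1<..<1} \<gamma>"
    unfolding \<gamma>_def s_def
    by (intro smooth_intros) (use s s0 in \<open>auto simp: s_def\<close>)
  have "\<gamma> t \<in> cotangent_S3" for t
  proof -
    have n: "(\<xi> + t *\<^sub>R a) \<bullet> (\<xi> + t *\<^sub>R a) = s t"
      by (simp add: inner_add_left inner_add_right * s_def)
    have m: "(\<xi> + t *\<^sub>R a) \<bullet> (\<eta> + t *\<^sub>R b) = t * t * (a \<bullet> b)"
      by (simp add: inner_add_left inner_add_right * b algebra_simps)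
    have "inverse (sqrt (s t)) * inverse (sqrt (s t)) = inverse (s t)"
      using s[of t] by (simp flip: inverse_mult_distrib)
    then have "inverse (sqrt (s t)) * (inverse (sqrt (s t)) * s t) = 1"
      using s0[of t] by (simp flip: mult.assoc)
    then show ?thesis
      unfolding \<gamma>_def cotangent_S3_iff fst_conv snd_conv inner_scaleR_left inner_scaleR_right
        inner_diff_right n m using s0[of t] by simp
  qed
  then have image: "\<gamma> ` {-1<..<1} \<subseteq> cotangent_S3" by blast
  have "(\<gamma> has_vector_derivative v) (at 0)"
    unfolding has_vector_derivative_def \<gamma>_def s_def
    by (auto intro!: derivative_eq_intros simp: zv algebra_simps)
  then show "v \<in> tangent_space cotangent_S3 z"
    unfolding tangent_space_def
    by (intro CollectI exI[of _ 1] conjI exI[of _ \<gamma>] smooth image) (auto simp: \<gamma>_def s_def zv)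
qed

lemma tangent_space_unit_cotangent_S3:
  assumes "z \<in> unit_cotangent_S3" "v \<in> tangent_space unit_cotangent_S3 z"
  shows "snd z \<bullet> snd v = 0"
proof -
  have "2 * (snd z \<bullet> snd v) = 0"
    by (rule tangent_space_level[OF assms(2) _ _ assms(1), where f = "\<lambda>y. snd y \<bullet> snd y"])
      (auto simp: unit_cotangent_S3_def inner_commute intro!: derivative_eq_intros)
  then show ?thesis by simp
qed

lemma cotangent_S3_fieldD:
  assumes "vector_field cotangent_S3 X" "z \<in> cotangent_S3"
  shows "fst z \<bullet> fst (X z) = 0" "snd z \<bullet> fst (X z) + fst z \<bullet> snd (X z) = 0"
  using vector_fieldD(2)[OF assms] tangent_space_cotangent_S3[OF assms(2)] by auto

section \<open>The canonical symplectic form and its Liouville field\<close>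

lemma bounded_bilinear_omega_std: "bounded_bilinear (omega_std x)"
  unfolding bilinear_conv_bounded_bilinear[symmetric] bilinear_def
  by (auto simp: omega_std_def inner_simps algebra_simps intro!: linearI)

text \<open>\<open>omega_std\<close> has constant coefficients, so its base point can be frozen at
  \<open>x\<close> and only the fields are differentiated.\<close>

lemma dird_omega_std:
  assumes "X x \<in> tangent_space W x" "x \<in> W" "smooth_map W Y" "smooth_map W Z"
  shows "dird W X (\<lambda>z. omega_std z (Y z) (Z z)) x
    = omega_std x (Y x) (dird W X Z x) + omega_std x (dird W X Y x) (Z x)"
proof -
  have "(\<lambda>z. omega_std z (Y z) (Z z)) = (\<lambda>z. omega_std x (Y z) (Z z))"
    by (simp add: omega_std_def)
  then show ?thesis using dird_bilinear[of _ X, OF bounded_bilinear_omega_std assms, of x] by simp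
qed

lemma symplectic_form_omega_std: "symplectic_form cotangent_S3 omega_std"
  unfolding symplectic_form_def
proof (intro conjI ballI allI impI)
  show "smooth_bilinear_form cotangent_S3 omega_std"
    unfolding smooth_bilinear_form_def
  proof (intro conjI ballI allI impI)
    show "bilinear (omega_std x)" for x
      using bounded_bilinear_omega_std by (simp add: bilinear_conv_bounded_bilinear)
    show "smooth_map cotangent_S3 (\<lambda>x. omega_std x (X x) (Y x))"
      if "vector_field cotangent_S3 X" "vector_field cotangent_S3 Y" for X Y
      unfolding omega_std_def by (intro smooth_intros vector_fieldD(1) that)
  qed
  show "omega_std x v v = 0" for x v by (simp add: omega_std_def)
next
  fix z u assume z: "z \<in> cotangent_S3" and u: "u \<in> tangent_space cotangent_S3 z" "u \<noteq> 0"
  obtain \<xi> \<eta> a b where eqs: "z = (\<xi>, \<eta>)" "u = (a, b)" by fastforce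
  have *: "\<xi> \<bullet> \<xi> = 1" "\<xi> \<bullet> \<eta> = 0" "\<xi> \<bullet> a = 0" "\<eta> \<bullet> a + \<xi> \<bullet> b = 0"
    using u(1) z unfolding tangent_space_cotangent_S3[OF z] cotangent_S3_iff by (simp_all add: eqs)
  \<comment> \<open>If \<open>a \<noteq> 0\<close>, the vertical vector \<open>(0, a)\<close> is
    tangent and pairs to \<open>a \<bullet> a\<close>. If \<open>a = 0\<close>, then
    \<open>b\<close> is orthogonal to \<xi> and can serve as a base direction; the multiple of \<xi>
    in the fibre restores the second tangency equation, and the pairing is
    \<open>- (b \<bullet> b)\<close>.\<close>
  show "\<exists>v\<in>tangent_space cotangent_S3 z. omega_std z u v \<noteq> 0"
  proof (cases "a = 0")
    case False
    then show ?thesis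
      by (intro bexI[of _ "(0, a)"])
        (auto simp: omega_std_def tangent_space_cotangent_S3[OF z[unfolded eqs]] eqs *)
  next
    case True
    then show ?thesis using u(2) *
      by (intro bexI[of _ "(b, - (\<eta> \<bullet> b) *\<^sub>R \<xi>)"])
        (auto simp: omega_std_def tangent_space_cotangent_S3[OF z[unfolded eqs]] eqs zero_prod_def)
  qed
next
  fix X Y Z x
  assume fields: "vector_field cotangent_S3 X" "vector_field cotangent_S3 Y" "vector_field cotangent_S3 Z"
    and x: "x \<in> cotangent_S3"
  have *: "dird cotangent_S3 X (\<lambda>z. omega_std z (Y z) (Z z)) x
      = omega_std x (Y x) (dird cotangent_S3 X Z x) + omega_std x (dird cotangent_S3 X Y x) (Z x)"
    if "vector_field cotangent_S3 X" "vector_field cotangent_S3 Y" "vector_field cotangent_S3 Z" for X Y Z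
    by (intro dird_omega_std vector_fieldD that x)
  show "dird cotangent_S3 X (\<lambda>z. omega_std z (Y z) (Z z)) x
      + dird cotangent_S3 Y (\<lambda>z. omega_std z (Z z) (X z)) x
      + dird cotangent_S3 Z (\<lambda>z. omega_std z (X z) (Y z)) x
      - omega_std x (lie_bracket cotangent_S3 X Y x) (Z x)
      - omega_std x (lie_bracket cotangent_S3 Y Z x) (X x)
      - omega_std x (lie_bracket cotangent_S3 Z X x) (Y x) = 0"
    \<comment> \<open>Each of the six derivatives of one field along another occurs once through the
      Leibniz rule and once in a bracket; antisymmetry cancels them.\<close>
    unfolding *[OF fields] *[OF fields(2,3,1)] *[OF fields(3,1,2)]
      lie_bracket_def
    by (simp add: omega_std_def inner_simps inner_commute)
qed

lemma liouville_field_cotangent_S3: "liouville_field cotangent_S3 omega_std (\<lambda>z. (0, snd z))"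
proof -
  let ?V = "\<lambda>z :: (real^4) \<times> (real^4). (0 :: real^4, snd z)"
  have lin: "bounded_linear ?V"
    by (intro bounded_linear_Pair bounded_linear_zero bounded_linear_snd)
  have V: "vector_field cotangent_S3 ?V"
    using smooth_map_linear[OF lin]
    by (auto simp: vector_field_def tangent_space_cotangent_S3 cotangent_S3_iff)
  have "dird cotangent_S3 ?V (\<lambda>z. omega_std z (X z) (Y z)) x
      - omega_std x (lie_bracket cotangent_S3 ?V X x) (Y x)
      - omega_std x (X x) (lie_bracket cotangent_S3 ?V Y x) = omega_std x (X x) (Y x)"
    if X: "vector_field cotangent_S3 X" and Y: "vector_field cotangent_S3 Y" and x: "x \<in> cotangent_S3"
    for X Y x
  proof -
    \<comment> \<open>\<open>?V\<close> restricts a linear map, so it is its own derivative. The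
      derivatives of \<open>X\<close> and \<open>Y\<close> along \<open>?V\<close> cancel, and what
      remains holds because each summand of \<open>omega_std\<close> contains exactly one fibre
      component.\<close>
    have "dird cotangent_S3 X ?V x = ?V (X x)" "dird cotangent_S3 Y ?V x = ?V (Y x)"
      by (intro dird_eq vector_fieldD(2)[OF X x] vector_fieldD(2)[OF Y x]
          bounded_linear_imp_has_derivative lin)+
    then show ?thesis
      unfolding dird_omega_std[of ?V, OF vector_fieldD(2)[OF V x] x vector_fieldD(1)[OF X]
          vector_fieldD(1)[OF Y]] lie_bracket_def
      by (simp add: omega_std_def inner_simps inner_commute)
  qed
  then show ?thesis using V by (simp add: liouville_field_def)
qed

text \<open>The orthogonal projection onto the tangent space; the normal space of \<open>T\<^sup>*S\<^sup>3\<close> at \<open>(\<xi>, \<eta>)\<close> is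
  spanned by the orthogonal vectors \<open>(\<xi>, 0)\<close> and \<open>(\<eta>, \<xi>)\<close>.\<close>

definition tangent_proj :: "(real^4) \<times> (real^4) \<Rightarrow> (real^4) \<times> (real^4) \<Rightarrow> (real^4) \<times> (real^4)" where
  "tangent_proj z w = w - (fst z \<bullet> fst w) *\<^sub>R (fst z, 0)
    - ((snd z \<bullet> fst w + fst z \<bullet> snd w) / (1 + snd z \<bullet> snd z)) *\<^sub>R (snd z, fst z)"

lemma one_plus_inner_nonzero: "1 + (v::'a::real_inner) \<bullet> v \<noteq> 0"
  using inner_ge_zero[of v] by linarith

lemma tangent_proj_add: "tangent_proj z (u + v) = tangent_proj z u + tangent_proj z v"
  by (simp add: tangent_proj_def inner_simps add_divide_distrib algebra_simps)

lemma tangent_proj_scaleR: "tangent_proj z (c *\<^sub>R u) = c *\<^sub>R tangent_proj z u"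
  by (simp add: tangent_proj_def scaleR_diff_right flip: distrib_left)

lemma tangent_proj_tangent:
  assumes "z \<in> cotangent_S3"
  shows "tangent_proj z w \<in> tangent_space cotangent_S3 z"
proof -
  have *: "fst z \<bullet> fst z = 1" "fst z \<bullet> snd z = 0" "snd z \<bullet> fst z = 0"
    using assms by (auto simp: cotangent_S3_iff inner_commute)
  have "snd z \<bullet> fst (tangent_proj z w) + fst z \<bullet> snd (tangent_proj z w)
    = (snd z \<bullet> fst w + fst z \<bullet> snd w)
      - ((snd z \<bullet> fst w + fst z \<bullet> snd w) / (1 + snd z \<bullet> snd z)) * (1 + snd z \<bullet> snd z)"
    by (simp only: tangent_proj_def) (simp add: inner_simps * distrib_left)
  also have "\<dots> = 0" using one_plus_inner_nonzero[of "snd z"] by simp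
  finally show ?thesis
    by (simp add: tangent_space_cotangent_S3[OF assms]) (simp add: tangent_proj_def inner_simps *)
qed

lemma tangent_proj_id:
  "z \<in> cotangent_S3 \<Longrightarrow> w \<in> tangent_space cotangent_S3 z \<Longrightarrow> tangent_proj z w = w"
  by (simp add: tangent_space_cotangent_S3 tangent_proj_def)

text \<open>The two directions removed by the projection are orthogonal to the tangent space; this
  yields metric compatibility.\<close>

lemma inner_tangent_proj:
  assumes "z \<in> cotangent_S3" "v \<in> tangent_space cotangent_S3 z"
  shows "tangent_proj z w \<bullet> v = w \<bullet> v"
proof -
  have v: "fst z \<bullet> fst v = 0" "snd z \<bullet> fst v + fst z \<bullet> snd v = 0"
    using assms by (auto simp: tangent_space_cotangent_S3)
  define k where "k = (snd z \<bullet> fst w + fst z \<bullet> snd w) / (1 + snd z \<bullet> snd z)"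
  have "tangent_proj z w \<bullet> v = w \<bullet> v - (fst z \<bullet> fst w) * (fst z \<bullet> fst v)
      - k * (snd z \<bullet> fst v + fst z \<bullet> snd v)"
    by (simp add: tangent_proj_def inner_diff_left flip: k_def)
      (simp add: inner_prod_def distrib_left)
  then show ?thesis by (simp add: v)
qed

text \<open>The vector (0, \<eta>) is orthogonal to both normals, hence blind to the projection. In
  the Hessian this cancels the term with the derivative of \<open>X\<close>.\<close>

lemma snd_inner_tangent_proj:
  "z \<in> cotangent_S3 \<Longrightarrow> snd z \<bullet> snd (tangent_proj z w) = snd z \<bullet> snd w"
  by (simp add: tangent_proj_def inner_simps cotangent_S3_iff inner_commute)

text \<open>Differentiating the two tangency equations of \<open>Y\<close> along \<open>X\<close>
  gives expressions in the derivative of \<open>Y\<close> whose right-hand sides are symmetric in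
  \<open>X\<close> and \<open>Y\<close>, so they cancel in the difference.\<close>

lemma lie_bracket_cotangent_S3:
  assumes X: "vector_field cotangent_S3 X" and Y: "vector_field cotangent_S3 Y" and x: "x \<in> cotangent_S3"
  shows "lie_bracket cotangent_S3 X Y x \<in> tangent_space cotangent_S3 x"
proof -
  have *: "fst x \<bullet> fst (dird cotangent_S3 X Y x) = - (fst (X x) \<bullet> fst (Y x))"
    "snd x \<bullet> fst (dird cotangent_S3 X Y x) + fst x \<bullet> snd (dird cotangent_S3 X Y x)
      = - (snd (X x) \<bullet> fst (Y x)) - fst (X x) \<bullet> snd (Y x)"
    if X: "vector_field cotangent_S3 X" and Y: "vector_field cotangent_S3 Y" for X Y
  proof -
    note tx = vector_fieldD(2)[OF X x] and sY = vector_fieldD(1)[OF Y]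
    note bl = dird_bilinear[of _ X, OF bounded_bilinear_inner tx x]
      and ln = dird_linear[of _ X, OF bounded_linear_fst tx x] dird_linear[of _ X, OF bounded_linear_snd tx x]
    have "0 = dird cotangent_S3 X (\<lambda>z. fst z \<bullet> fst (Y z)) x"
      using dird_cong[of X, OF tx x smooth_map_const[of _ 0], of "\<lambda>z. fst z \<bullet> fst (Y z)"]
        cotangent_S3_fieldD[OF Y] dird_const[of X, OF tx, of 0] by simp
    also have "\<dots> = fst x \<bullet> fst (dird cotangent_S3 X Y x) + fst (X x) \<bullet> fst (Y x)"
      using bl[of fst "\<lambda>z. fst (Y z)"] ln(1)[OF sY] ln(1)[of "\<lambda>z. z"] dird_id[of X, OF tx]
      by (simp add: smooth_map_fst smooth_map_id sY)
    finally show "fst x \<bullet> fst (dird cotangent_S3 X Y x) = - (fst (X x) \<bullet> fst (Y x))" by simp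
    have "0 = dird cotangent_S3 X (\<lambda>z. snd z \<bullet> fst (Y z) + fst z \<bullet> snd (Y z)) x"
      using dird_cong[of X, OF tx x smooth_map_const[of _ 0], of "\<lambda>z. snd z \<bullet> fst (Y z) + fst z \<bullet> snd (Y z)"]
        cotangent_S3_fieldD[OF Y] dird_const[of X, OF tx, of 0] by simp
    also have "\<dots> = dird cotangent_S3 X (\<lambda>z. snd z \<bullet> fst (Y z)) x
        + dird cotangent_S3 X (\<lambda>z. fst z \<bullet> snd (Y z)) x"
      by (intro dird_add tx x smooth_intros sY)
    also have "\<dots> = snd x \<bullet> fst (dird cotangent_S3 X Y x) + snd (X x) \<bullet> fst (Y x)
        + (fst x \<bullet> snd (dird cotangent_S3 X Y x) + fst (X x) \<bullet> snd (Y x))"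
      using bl[of snd "\<lambda>z. fst (Y z)"] bl[of fst "\<lambda>z. snd (Y z)"] ln[OF sY] ln[of "\<lambda>z. z"]
        dird_id[of X, OF tx]
      by (simp add: smooth_map_fst smooth_map_snd smooth_map_id sY)
    finally show "snd x \<bullet> fst (dird cotangent_S3 X Y x) + fst x \<bullet> snd (dird cotangent_S3 X Y x)
      = - (snd (X x) \<bullet> fst (Y x)) - fst (X x) \<bullet> snd (Y x)" by simp
  qed
  show ?thesis
    using *[OF X Y] *[OF Y X]
    by (simp add: tangent_space_cotangent_S3[OF x] lie_bracket_def inner_simps inner_commute)
qed

section \<open>A conformal metric and its Levi-Civita connection\<close>

definition conformal_metric :: "(real^4) \<times> (real^4) \<Rightarrow> (real^4) \<times> (real^4) \<Rightarrow> (real^4) \<times> (real^4) \<Rightarrow> real" where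
  "conformal_metric z u v = exp (snd z \<bullet> snd z) * (u \<bullet> v)"

text \<open>\<open>\<nabla>\<^sub>X Y + X(f) Y + Y(f) X - \<langle>X, Y\<rangle> grad f\<close>, where \<open>\<nabla>\<close> is the connection of the induced metric,
  \<open>f = \<parallel>\<eta>\<parallel>\<^sup>2 / 2\<close> and \<open>grad f = (0, \<eta>)\<close>.\<close>

definition conformal_connection ::
    "((real^4) \<times> (real^4) \<Rightarrow> (real^4) \<times> (real^4)) \<Rightarrow> ((real^4) \<times> (real^4) \<Rightarrow> (real^4) \<times> (real^4)) \<Rightarrow>
     (real^4) \<times> (real^4) \<Rightarrow> (real^4) \<times> (real^4)" where
  "conformal_connection X Y z = tangent_proj z (dird cotangent_S3 X Y z)
     + (snd z \<bullet> snd (X z)) *\<^sub>R Y z + (snd z \<bullet> snd (Y z)) *\<^sub>R X z - (X z \<bullet> Y z) *\<^sub>R (0, snd z)"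

lemma riemannian_metric_conformal: "riemannian_metric cotangent_S3 conformal_metric"
  unfolding riemannian_metric_def smooth_bilinear_form_def
proof (intro conjI ballI allI impI)
  show "bilinear (conformal_metric x)" for x
    by (auto simp: bilinear_def conformal_metric_def inner_simps algebra_simps intro!: linearI)
  show "smooth_map cotangent_S3 (\<lambda>x. conformal_metric x (X x) (Y x))"
    if "vector_field cotangent_S3 X" "vector_field cotangent_S3 Y" for X Y
    unfolding conformal_metric_def by (intro smooth_intros vector_fieldD(1) that)
qed (auto simp: conformal_metric_def inner_commute)

lemma vector_field_conformal_connection:
  assumes X: "vector_field cotangent_S3 X" and Y: "vector_field cotangent_S3 Y"
  shows "vector_field cotangent_S3 (conformal_connection X Y)"
  unfolding vector_field_def
proof (intro conjI ballI)
  note s = vector_fieldD(1)[OF X] vector_fieldD(1)[OF Y]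
    smooth_map_dird[OF X vector_fieldD(1)[OF Y]]
  show "smooth_map cotangent_S3 (conformal_connection X Y)"
    unfolding conformal_connection_def[abs_def] tangent_proj_def
    by (intro smooth_intros s one_plus_inner_nonzero)
  \<comment> \<open>All four terms are tangent; for the last one this is
    \<open>fst z \<bullet> snd z = 0\<close>.\<close>
  show "conformal_connection X Y z \<in> tangent_space cotangent_S3 z" if z: "z \<in> cotangent_S3" for z
    using tangent_proj_tangent[OF z, of "dird cotangent_S3 X Y z"] cotangent_S3_fieldD[OF X z]
      cotangent_S3_fieldD[OF Y z] z
    by (simp add: tangent_space_cotangent_S3[OF z] conformal_connection_def inner_simps cotangent_S3_iff)
      algebra
qed

lemma affine_connection_conformal: "affine_connection cotangent_S3 conformal_connection"
  unfolding affine_connection_def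
proof (intro conjI allI impI ballI vector_field_conformal_connection)
  fix X X' Y x
  assume "vector_field cotangent_S3 X" "vector_field cotangent_S3 X'" "vector_field cotangent_S3 Y" "x \<in> cotangent_S3"
  then show "conformal_connection (\<lambda>z. X z + X' z) Y x = conformal_connection X Y x + conformal_connection X' Y x"
    by (simp add: conformal_connection_def dird_field_linear vector_fieldD(1) tangent_proj_add
        inner_simps algebra_simps)
next
  fix X Y Y' x
  assume "vector_field cotangent_S3 X" "vector_field cotangent_S3 Y" "vector_field cotangent_S3 Y'" "x \<in> cotangent_S3"
  then show "conformal_connection X (\<lambda>z. Y z + Y' z) x = conformal_connection X Y x + conformal_connection X Y' x"
    by (simp add: conformal_connection_def dird_add vector_fieldD tangent_proj_add
        inner_simps algebra_simps)
next
  fix f :: "(real^4) \<times> (real^4) \<Rightarrow> real" and X Y x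
  assume "smooth_map cotangent_S3 f" "vector_field cotangent_S3 X" "vector_field cotangent_S3 Y" "x \<in> cotangent_S3"
  then show "conformal_connection (\<lambda>z. f z *\<^sub>R X z) Y x = f x *\<^sub>R conformal_connection X Y x"
    by (simp add: conformal_connection_def dird_field_linear vector_fieldD(1) tangent_proj_scaleR
        inner_simps algebra_simps)
next
  fix f :: "(real^4) \<times> (real^4) \<Rightarrow> real" and X Y x
  assume "smooth_map cotangent_S3 f" "vector_field cotangent_S3 X" "vector_field cotangent_S3 Y" "x \<in> cotangent_S3"
  \<comment> \<open>The extra term with the derivative of \<open>f\<close> is a multiple of
    \<open>Y x\<close>, which the projection fixes.\<close>
  then show "conformal_connection X (\<lambda>z. f z *\<^sub>R Y z) x
      = dird cotangent_S3 X f x *\<^sub>R Y x + f x *\<^sub>R conformal_connection X Y x"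
    by (simp add: conformal_connection_def dird_bilinear[OF bounded_bilinear_scaleR] vector_fieldD
        tangent_proj_add tangent_proj_scaleR tangent_proj_id inner_simps algebra_simps)
qed

lemma levi_civita_conformal: "levi_civita cotangent_S3 conformal_metric conformal_connection"
  unfolding levi_civita_def
proof (intro conjI affine_connection_conformal allI impI ballI)
  fix X Y x
  assume XY: "vector_field cotangent_S3 X" "vector_field cotangent_S3 Y" and x: "x \<in> cotangent_S3"
  \<comment> \<open>The conformal correction terms are symmetric in \<open>X\<close> and
    \<open>Y\<close>, so the torsion is that of the projected derivative.\<close>
  have "conformal_connection X Y x - conformal_connection Y X x
      = tangent_proj x (dird cotangent_S3 X Y x) - tangent_proj x (dird cotangent_S3 Y X x)"
    by (simp add: conformal_connection_def inner_commute)
  also have "\<dots> = tangent_proj x (lie_bracket cotangent_S3 X Y x)"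
    using tangent_proj_add[of x "lie_bracket cotangent_S3 X Y x" "dird cotangent_S3 Y X x"]
    by (simp add: lie_bracket_def)
  also have "\<dots> = lie_bracket cotangent_S3 X Y x"
    by (intro tangent_proj_id lie_bracket_cotangent_S3 XY x)
  finally show "conformal_connection X Y x - conformal_connection Y X x = lie_bracket cotangent_S3 X Y x" .
next
  fix X Y Z x
  assume X: "vector_field cotangent_S3 X" and Y: "vector_field cotangent_S3 Y"
    and Z: "vector_field cotangent_S3 Z" and x: "x \<in> cotangent_S3"
  let ?d = "dird cotangent_S3 Z" and ?e = "exp (snd x \<bullet> snd x)" and ?D = "conformal_connection Z"
  note tz = vector_fieldD(2)[OF Z x] and sm = vector_fieldD(1)[OF X] vector_fieldD(1)[OF Y]
  have e: "?d (\<lambda>z. exp (snd z \<bullet> snd z)) x = ?e * (2 * (snd x \<bullet> snd (Z x)))"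
    by (rule dird_eq[of Z, OF tz]) (auto intro!: derivative_eq_intros simp: inner_commute)
  have se: "smooth_map cotangent_S3 (\<lambda>z::(real^4)\<times>(real^4). exp (snd z \<bullet> snd z))"
    and si: "smooth_map cotangent_S3 (\<lambda>z. X z \<bullet> Y z)"
    by (intro smooth_intros sm)+
  have "?d (\<lambda>z. conformal_metric z (X z) (Y z)) x
      = ?e * (2 * (snd x \<bullet> snd (Z x)) * (X x \<bullet> Y x) + ?d X x \<bullet> Y x + X x \<bullet> ?d Y x)"
    unfolding conformal_metric_def dird_bilinear[of _ Z, OF bounded_bilinear_mult tz x se si]
      dird_bilinear[of _ Z, OF bounded_bilinear_inner tz x sm] e by (simp add: algebra_simps)
  also have "\<dots> = ?e * (?D X x \<bullet> Y x + X x \<bullet> ?D Y x)"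
  proof -
    \<comment> \<open>In the sum of this and its counterpart the last two terms cancel, and the two
      copies of \<open>(snd x \<bullet> snd (Z x)) * (X x \<bullet> Y x)\<close> account for the
      derivative of the conformal factor.\<close>
    have "?D X x \<bullet> Y x = ?d X x \<bullet> Y x + (snd x \<bullet> snd (Z x)) * (X x \<bullet> Y x)
      + (snd x \<bullet> snd (X x)) * (Z x \<bullet> Y x) - (Z x \<bullet> X x) * (snd x \<bullet> snd (Y x))"
    unfolding conformal_connection_def inner_diff_left inner_add_left
      inner_tangent_proj[OF x vector_fieldD(2)[OF Y x]]
    by (simp add: inner_prod_def distrib_left)
  moreover have "X x \<bullet> ?D Y x = X x \<bullet> ?d Y x + (snd x \<bullet> snd (Z x)) * (X x \<bullet> Y x)
      + (snd x \<bullet> snd (Y x)) * (Z x \<bullet> X x) - (Z x \<bullet> Y x) * (snd x \<bullet> snd (X x))"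
    unfolding conformal_connection_def inner_diff_left inner_add_left inner_commute[of "X x"]
      inner_tangent_proj[OF x vector_fieldD(2)[OF X x]]
    by (simp add: inner_prod_def distrib_left)
    ultimately show ?thesis by simp
  qed
  finally show "?d (\<lambda>z. conformal_metric z (X z) (Y z)) x
      = conformal_metric x (?D X x) (Y x) + conformal_metric x (X x) (?D Y x)"
    by (simp add: conformal_metric_def[of x] distrib_left)
qed

text \<open>Here H = f - 1/2, so dH = df and the gradient of H is (0, \<eta>). The negative square
  comes from the terms X(f) X of the connection and vanishes when \<open>X x\<close> is tangent to a
  level set of H.\<close>

lemma hessian_conformal:
  assumes X: "vector_field cotangent_S3 X" and x: "x \<in> cotangent_S3"
  shows "hessian cotangent_S3 conformal_connection (\<lambda>z. (snd z \<bullet> snd z - 1) / 2) X X x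
    = snd (X x) \<bullet> snd (X x) - 2 * (snd x \<bullet> snd (X x))\<^sup>2 + (X x \<bullet> X x) * (snd x \<bullet> snd x)"
proof -
  let ?H = "\<lambda>z::(real^4) \<times> (real^4). (snd z \<bullet> snd z - 1) / 2"
  note tx = vector_fieldD(2)[OF X x] and sX = vector_fieldD(1)[OF X]
  have dH: "dird cotangent_S3 Y ?H z = snd z \<bullet> snd (Y z)"
    if "vector_field cotangent_S3 Y" "z \<in> cotangent_S3" for Y z
    by (rule dird_eq[of Y, OF vector_fieldD(2)[OF that]]) (auto intro!: derivative_eq_intros simp: inner_commute)
  have "dird cotangent_S3 X (dird cotangent_S3 X ?H) x = dird cotangent_S3 X (\<lambda>z. snd z \<bullet> snd (X z)) x"
    by (intro dird_cong tx x smooth_intros sX dH X)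
  also have "\<dots> = snd x \<bullet> snd (dird cotangent_S3 X X x) + snd (X x) \<bullet> snd (X x)"
    using dird_bilinear[of _ X, OF bounded_bilinear_inner tx x, of snd "\<lambda>z. snd (X z)"]
      dird_linear[of _ X, OF bounded_linear_snd tx x sX] dird_id[of X, OF tx]
      dird_linear[of _ X, OF bounded_linear_snd tx x, of "\<lambda>z. z"]
    by (simp add: smooth_map_snd smooth_map_id sX)
  finally show ?thesis
    unfolding hessian_def dH[OF vector_field_conformal_connection[OF X X] x]
    unfolding conformal_connection_def snd_add snd_diff snd_scaleR inner_add_right inner_diff_right
      inner_scaleR_right snd_inner_tangent_proj[OF x]
    by (simp add: power2_eq_square)
qed

section \<open>Charts and strict convexity\<close>

lemma diffeo_betwI:
  assumes "\<And>x. x \<in> A \<Longrightarrow> f x \<in> B \<and> g (f x) = x" "\<And>y. y \<in> B \<Longrightarrow> g y \<in> A \<and> f (g y) = y"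
    and "smooth_map A f" "smooth_map B g"
  shows "diffeo_betw A B f"
proof -
  have bij: "bij_betw f A B" by (rule bij_betw_byWitness[where f' = g]) (use assms in auto)
  \<comment> \<open>\<open>inv_into A f\<close> agrees with \<open>g\<close> only on
    \<open>B\<close>, and smoothness on \<open>B\<close> sees no other values.\<close>
  moreover have "smooth_map B (inv_into A f)"
  proof (rule smooth_map_cong[OF assms(4)])
    show "g y = inv_into A f y" if "y \<in> B" for y
      using assms(2)[OF that] bij by (metis bij_betw_inv_into_left)
  qed
  ultimately show ?thesis using assms(3) by (simp add: diffeo_betw_def)
qed

text \<open>Nonzero orthogonal vectors are independent, so this is the orthogonal complement of a
  plane. It gives the fibre directions in the chart of the unit bundle.\<close>

lemma dim_orthogonal_pair:
  fixes \<xi> \<eta> :: "'a::euclidean_space"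
  assumes "\<xi> \<noteq> 0" "\<eta> \<noteq> 0" "\<xi> \<bullet> \<eta> = 0"
  shows "dim {b. \<xi> \<bullet> b = 0 \<and> \<eta> \<bullet> b = 0} = DIM('a) - 2"
proof -
  have ne: "\<xi> \<noteq> \<eta>" using assms by auto
  have "pairwise orthogonal {\<xi>, \<eta>}"
    using assms by (auto simp: pairwise_def orthogonal_def inner_commute)
  then have "independent {\<xi>, \<eta>}" using assms by (intro pairwise_orthogonal_independent) auto
  then have "dim (span {\<xi>, \<eta>}) = 2" using ne by (simp add: dim_eq_card_independent)
  moreover have "{y \<in> UNIV. \<forall>x\<in>span {\<xi>, \<eta>}. orthogonal x y} = {b. \<xi> \<bullet> b = 0 \<and> \<eta> \<bullet> b = 0}"
  proof (intro set_eqI iffI CollectI conjI ballI)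
    fix y assume "y \<in> {y \<in> UNIV. \<forall>x\<in>span {\<xi>, \<eta>}. orthogonal x y}"
    then show "\<xi> \<bullet> y = 0" "\<eta> \<bullet> y = 0" by (auto simp: orthogonal_def span_base)
  next
    fix y x assume y: "y \<in> {b. \<xi> \<bullet> b = 0 \<and> \<eta> \<bullet> b = 0}" and "x \<in> span {\<xi>, \<eta>}"
    then have "orthogonal y x"
      by (intro orthogonal_to_span[of x "{\<xi>, \<eta>}"]) (auto simp: orthogonal_def inner_commute)
    then show "orthogonal x y" by (simp add: orthogonal_commute)
  qed simp
  ultimately show ?thesis
    using dim_subspace_orthogonal_to_vectors[of "span {\<xi>, \<eta>}" "UNIV :: 'a set"] by simp
qed

lemma normalize_unit:
  fixes v :: "'a::real_inner"
  assumes "v \<noteq> 0"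
  shows "(inverse (norm v) *\<^sub>R v) \<bullet> (inverse (norm v) *\<^sub>R v) = 1"
  using assms by (simp add: power2_norm_eq_inner[symmetric] power2_eq_square)

text \<open>Central projection from the affine plane \<xi> + a, with a orthogonal to \<xi>, charts
  an open hemisphere, and orthogonal projection along \<xi> identifies each fibre over it with the
  complement of \<xi>: 3 + 3 dimensions.\<close>

lemma submanifold_cotangent_S3: "submanifold 6 cotangent_S3"
  unfolding submanifold_def
proof
  fix z assume "z \<in> cotangent_S3"
  then obtain \<xi> \<eta> where z: "z = (\<xi>, \<eta>)" "\<xi> \<bullet> \<xi> = 1" "\<xi> \<bullet> \<eta> = 0"
    by (cases z) (auto simp: cotangent_S3_iff)
  define N where "N = cotangent_S3 \<inter> {w. 0 < \<xi> \<bullet> fst w}"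
  define S where "S = {a. \<xi> \<bullet> a = 0} \<times> {b. \<xi> \<bullet> b = 0}"
  \<comment> \<open>For w = (a, b), subtracting \<open>(a \<bullet> b) *\<^sub>R \<xi>\<close> from
    b makes it orthogonal to \<open>\<xi> + a\<close>; the inverse recovers b by dropping the
    \<xi>-component.\<close>
  define \<phi> where "\<phi> = (\<lambda>w :: (real^4) \<times> (real^4).
    (inverse (norm (\<xi> + fst w)) *\<^sub>R (\<xi> + fst w), snd w - (fst w \<bullet> snd w) *\<^sub>R \<xi>))"
  define \<psi> where "\<psi> = (\<lambda>w. (inverse (\<xi> \<bullet> fst w) *\<^sub>R fst w - \<xi>, snd w - (\<xi> \<bullet> snd w) *\<^sub>R \<xi>))"
  have "openin (top_of_set cotangent_S3) N"
    unfolding N_def by (intro openin_open_Int open_Collect_less continuous_intros)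
  moreover have "z \<in> N" using z by (simp add: N_def cotangent_S3_iff)
  moreover have S: "subspace S" unfolding S_def by (intro subspace_Times subspace_hyperplane)
  moreover have "dim S = 6"
  proof -
    have "\<xi> \<noteq> 0" using z by auto
    then show ?thesis unfolding S_def by (simp add: dim_Times subspace_hyperplane dim_hyperplane)
  qed
  moreover have "diffeo_betw S N \<phi>"
  proof (rule diffeo_betwI[where g = \<psi>])
    have S_nonzero: "\<xi> + fst w \<noteq> 0" if "w \<in> S" for w
    proof
      assume "\<xi> + fst w = 0"
      then have "\<xi> \<bullet> (\<xi> + fst w) = 0" by simp
      then show False using that z by (auto simp: inner_add_right S_def)
    qed
    then show "smooth_map S \<phi>" unfolding \<phi>_def by (intro smooth_intros) auto
    show "smooth_map N \<psi>" unfolding \<psi>_def by (intro smooth_intros) (auto simp: N_def)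
    fix w assume w: "w \<in> S"
    then obtain a b where ab: "w = (a, b)" "\<xi> \<bullet> a = 0" "\<xi> \<bullet> b = 0" by (auto simp: S_def)
    have n: "norm (\<xi> + a) > 0" using S_nonzero[OF w] ab by simp
    have "\<phi> w \<in> N"
      using normalize_unit[of "\<xi> + a"] n z ab
      by (simp add: \<phi>_def N_def cotangent_S3_iff inner_simps inner_commute)
    moreover have "\<psi> (\<phi> w) = w"
      using n z by (simp add: \<phi>_def \<psi>_def ab inner_simps)
    ultimately show "\<phi> w \<in> N \<and> \<psi> (\<phi> w) = w" by blast
  next
    fix w assume "w \<in> N"
    then obtain x y where xy: "w = (x, y)" "x \<bullet> x = 1" "x \<bullet> y = 0" "0 < \<xi> \<bullet> x"
      by (cases w) (auto simp: N_def cotangent_S3_iff)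
    have "\<psi> w \<in> S" using xy z by (simp add: \<psi>_def S_def inner_simps)
    moreover have "\<phi> (\<psi> w) = w"
    proof -
      have "norm x = 1" using xy by (simp add: norm_eq_1)
      moreover have "(inverse (\<xi> \<bullet> x) *\<^sub>R x - \<xi>) \<bullet> (y - (\<xi> \<bullet> y) *\<^sub>R \<xi>) = - (\<xi> \<bullet> y)"
        using xy z by (simp add: inner_simps inner_commute)
      ultimately show ?thesis using xy by (simp add: \<phi>_def \<psi>_def)
    qed
    ultimately show "\<psi> w \<in> S \<and> \<phi> (\<psi> w) = w" by blast
  qed
  ultimately show "\<exists>N S A \<phi>. openin (top_of_set cotangent_S3) N \<and> z \<in> N \<and> subspace S \<and> dim S = 6 \<and>
      openin (top_of_set S) (A :: ((real^4) \<times> (real^4)) set) \<and> diffeo_betw A N \<phi>"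
    using openin_subtopology_self by blast
qed

text \<open>The base is charted as before, and the unit 2-sphere in the fibre by a second central
  projection around \<eta>: 3 + 2 dimensions.\<close>

lemma submanifold_unit_cotangent_S3: "submanifold 5 unit_cotangent_S3"
  unfolding submanifold_def
proof
  fix z assume "z \<in> unit_cotangent_S3"
  then obtain \<xi> \<eta> where z: "z = (\<xi>, \<eta>)" "\<xi> \<bullet> \<xi> = 1" "\<xi> \<bullet> \<eta> = 0" "\<eta> \<bullet> \<eta> = 1"
    by (cases z) (auto simp: cotangent_S3_iff unit_cotangent_S3_def)
  have z': "\<eta> \<bullet> \<xi> = 0" using z by (simp add: inner_commute)
  define N where "N = unit_cotangent_S3 \<inter> ({w. 0 < \<xi> \<bullet> fst w} \<inter> {w. 0 < \<eta> \<bullet> snd w})"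
  define S where "S = {a. \<xi> \<bullet> a = 0} \<times> {b. \<xi> \<bullet> b = 0 \<and> \<eta> \<bullet> b = 0}"
  \<comment> \<open>The vector \<eta> + b, tilted along \<xi> until it is orthogonal to \<xi> + a.
    Its product with \<eta> stays 1, so it is nonzero, and dividing by the \<eta>-component undoes
    the later normalisation.\<close>
  define h where "h = (\<lambda>w. \<eta> + snd w - ((\<eta> + snd w) \<bullet> fst w) *\<^sub>R \<xi>)"
  define \<phi> where "\<phi> = (\<lambda>w. (inverse (norm (\<xi> + fst w)) *\<^sub>R (\<xi> + fst w), inverse (norm (h w)) *\<^sub>R h w))"
  define \<psi> where "\<psi> = (\<lambda>w. (inverse (\<xi> \<bullet> fst w) *\<^sub>R fst w - \<xi>,
    inverse (\<eta> \<bullet> snd w) *\<^sub>R (snd w - (\<xi> \<bullet> snd w) *\<^sub>R \<xi>) - \<eta>))"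
  have "openin (top_of_set unit_cotangent_S3) N"
    unfolding N_def by (intro openin_open_Int open_Int open_Collect_less continuous_intros)
  moreover have "z \<in> N" using z by (simp add: N_def unit_cotangent_S3_def cotangent_S3_iff)
  moreover have sub: "subspace {b. \<xi> \<bullet> b = 0 \<and> \<eta> \<bullet> b = 0}"
    by (simp add: subspace_def inner_simps)
  then have S: "subspace S" unfolding S_def by (intro subspace_Times subspace_hyperplane)
  moreover have "dim S = 5"
  proof -
    have "\<xi> \<noteq> 0" "\<eta> \<noteq> 0" using z by auto
    then show ?thesis unfolding S_def
      by (simp add: dim_Times sub subspace_hyperplane dim_hyperplane dim_orthogonal_pair z)
  qed
  moreover have "diffeo_betw S N \<phi>"
  proof (rule diffeo_betwI[where g = \<psi>])
    have nonzero: "\<xi> + fst w \<noteq> 0" "h w \<noteq> 0" if "w \<in> S" for w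
    proof -
      have "\<xi> \<bullet> (\<xi> + fst w) = 1" "\<eta> \<bullet> h w = 1"
        using that z z' by (auto simp: inner_simps S_def h_def)
      then show "\<xi> + fst w \<noteq> 0" "h w \<noteq> 0" by auto
    qed
    have "smooth_map S h" unfolding h_def by (intro smooth_intros)
    then show "smooth_map S \<phi>" unfolding \<phi>_def using nonzero by (intro smooth_intros) auto
    show "smooth_map N \<psi>" unfolding \<psi>_def by (intro smooth_intros) (auto simp: N_def)
    fix w assume w: "w \<in> S"
    then obtain a b where ab: "w = (a, b)" "\<xi> \<bullet> a = 0" "\<xi> \<bullet> b = 0" "\<eta> \<bullet> b = 0" by (auto simp: S_def)
    have n: "norm (\<xi> + a) > 0" "norm (h w) > 0" using nonzero[OF w] ab by simp_all
    have i: "\<xi> \<bullet> h w = - ((\<eta> + b) \<bullet> a)" "\<eta> \<bullet> h w = 1" "(\<xi> + a) \<bullet> h w = 0"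
      using ab z z' by (simp_all add: h_def inner_simps inner_commute)
    have "\<phi> w \<in> N"
      using normalize_unit[of "\<xi> + a"] normalize_unit[of "h w"] n z i ab
      by (simp add: \<phi>_def N_def unit_cotangent_S3_def cotangent_S3_iff inner_add_right)
    moreover have "\<psi> (\<phi> w) = w"
    proof -
      have "h w + ((\<eta> + b) \<bullet> a) *\<^sub>R \<xi> = \<eta> + b" by (simp add: h_def ab)
      then have "inverse (\<eta> \<bullet> (inverse (norm (h w)) *\<^sub>R h w)) *\<^sub>R
          (inverse (norm (h w)) *\<^sub>R h w - (\<xi> \<bullet> (inverse (norm (h w)) *\<^sub>R h w)) *\<^sub>R \<xi>) = \<eta> + b"
        using n by (simp add: i scaleR_add_right flip: mult.assoc)
      then show ?thesis
        using n z by (simp add: \<phi>_def \<psi>_def ab inner_add_right)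
    qed
    ultimately show "\<phi> w \<in> N \<and> \<psi> (\<phi> w) = w" by blast
  next
    fix w assume "w \<in> N"
    then obtain x y where xy: "w = (x, y)" "x \<bullet> x = 1" "x \<bullet> y = 0" "y \<bullet> y = 1" "0 < \<xi> \<bullet> x" "0 < \<eta> \<bullet> y"
      by (cases w) (auto simp: N_def unit_cotangent_S3_def cotangent_S3_iff)
    have "\<psi> w \<in> S" using xy z z' by (simp add: \<psi>_def S_def inner_simps)
    moreover have "\<phi> (\<psi> w) = w"
    proof -
      have "norm x = 1" "norm y = 1" using xy by (simp_all add: norm_eq_1)
      moreover have "h (\<psi> w) = inverse (\<eta> \<bullet> y) *\<^sub>R y"
      proof -
        define k u a where "k = inverse (\<eta> \<bullet> y)" and "u = y - (\<xi> \<bullet> y) *\<^sub>R \<xi>"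
          and "a = inverse (\<xi> \<bullet> x) *\<^sub>R x - \<xi>"
        \<comment> \<open>By \<open>x \<bullet> y = 0\<close>, the tilt in \<open>h\<close> restores
          exactly the \<xi>-component that \<open>u\<close> lacks.\<close>
        have "u \<bullet> a = - (\<xi> \<bullet> y)"
          using xy z by (simp add: u_def a_def inner_simps inner_commute)
        moreover have "h (\<psi> w) = k *\<^sub>R u - (k * (u \<bullet> a)) *\<^sub>R \<xi>"
          by (simp add: h_def \<psi>_def xy(1) flip: k_def u_def a_def)
        ultimately show ?thesis by (simp add: k_def u_def scaleR_diff_right)
      qed
      ultimately show ?thesis using xy unfolding \<phi>_def by (simp add: \<psi>_def)
    qed
    ultimately show "\<psi> w \<in> S \<and> \<phi> (\<psi> w) = w" by blast
  qed
  ultimately show "\<exists>N S A \<phi>. openin (top_of_set unit_cotangent_S3) N \<and> z \<in> N \<and> subspace S \<and> dim S = 5 \<and>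
      openin (top_of_set S) (A :: ((real^4) \<times> (real^4)) set) \<and> diffeo_betw A N \<phi>"
    using openin_subtopology_self by blast
qed

section \<open>Contact type and strict convexity of the unit bundle\<close>

lemma contact_type_unit_cotangent_S3:
  "contact_type_hypersurface cotangent_S3 omega_std unit_cotangent_S3"
  unfolding contact_type_hypersurface_def
proof (intro conjI symplectic_form_omega_std exI[of _ 5] exI[of _ cotangent_S3] exI[of _ "\<lambda>z. (0, snd z)"]
    liouville_field_cotangent_S3 submanifold_unit_cotangent_S3 ballI)
  show "submanifold (Suc 5) cotangent_S3" using submanifold_cotangent_S3 by simp
  show "unit_cotangent_S3 \<subseteq> cotangent_S3" by (simp add: unit_cotangent_S3_def)
  then show "unit_cotangent_S3 \<subseteq> cotangent_S3" .
  \<comment> \<open>Tangent vectors of the unit bundle have fibre component orthogonal to \<eta>,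
    whereas the Liouville field pairs with \<eta> to 1.\<close>
  show "(0, snd z) \<notin> tangent_space unit_cotangent_S3 z" if "z \<in> unit_cotangent_S3" for z
    using tangent_space_unit_cotangent_S3[OF that, of "(0, snd z)"] that
    by (auto simp: unit_cotangent_S3_def)
qed simp

lemma strictly_convex_unit_cotangent_S3:
  "strictly_convex_hypersurface cotangent_S3 unit_cotangent_S3"
proof -
  \<comment> \<open>The collar scales covectors by 1 + t. With \<epsilon> = 1 the fibre norms fill
    the interval from 0 to 2, so the zero section, where the inverse breaks down, is left
    out.\<close>
  define U where "U = cotangent_S3 \<inter> ({w. 0 < norm (snd w)} \<inter> {w. norm (snd w) < 2})"
  define \<Phi> where "\<Phi> = (\<lambda>p :: real \<times> (real^4) \<times> (real^4). (fst (snd p), (1 + fst p) *\<^sub>R snd (snd p)))"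
  define \<Psi> where "\<Psi> = (\<lambda>w :: (real^4) \<times> (real^4). (norm (snd w) - 1, fst w, inverse (norm (snd w)) *\<^sub>R snd w))"
  define H where "H = (\<lambda>z :: (real^4) \<times> (real^4). (snd z \<bullet> snd z - 1) / 2)"
  have diffeo: "diffeo_betw ({-1<..<1} \<times> unit_cotangent_S3) U \<Phi>"
  proof (rule diffeo_betwI[where g = \<Psi>])
    show "smooth_map ({-1<..<1} \<times> unit_cotangent_S3) \<Phi>" unfolding \<Phi>_def by (intro smooth_intros)
    show "smooth_map U \<Psi>" unfolding \<Psi>_def by (intro smooth_intros) (auto simp: U_def)
    show "\<Phi> p \<in> U \<and> \<Psi> (\<Phi> p) = p" if "p \<in> {-1<..<1} \<times> unit_cotangent_S3" for p
    proof -
      obtain t \<xi> \<eta> where p: "p = (t, \<xi>, \<eta>)" "-1 < t" "t < 1" "\<xi> \<bullet> \<xi> = 1" "\<xi> \<bullet> \<eta> = 0" "norm \<eta> = 1"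
        using \<open>p \<in> _\<close> by (cases p) (auto simp: unit_cotangent_S3_def cotangent_S3_iff norm_eq_1)
      moreover from this have "\<eta> \<noteq> 0" by auto
      ultimately show ?thesis by (simp add: \<Phi>_def \<Psi>_def U_def cotangent_S3_iff)
    qed
    show "\<Psi> w \<in> {-1<..<1} \<times> unit_cotangent_S3 \<and> \<Phi> (\<Psi> w) = w" if "w \<in> U" for w
      using that normalize_unit[of "snd w"]
      by (auto simp: \<Phi>_def \<Psi>_def U_def unit_cotangent_S3_def cotangent_S3_iff)
  qed
  have "openin (top_of_set cotangent_S3) U"
    unfolding U_def by (intro openin_open_Int open_Int open_Collect_less continuous_intros)
  moreover have "Ck_map 2 U H"
    unfolding H_def by (intro smooth_map_Ck_map smooth_intros) simp
  moreover have "unit_cotangent_S3 = {x \<in> U. H x = 0}"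
    by (auto simp: U_def H_def unit_cotangent_S3_def norm_eq_sqrt_inner)
  moreover have "hessian cotangent_S3 conformal_connection H X X x > 0"
    if x: "x \<in> unit_cotangent_S3" and X: "vector_field cotangent_S3 X"
      and tangent: "X x \<in> tangent_space unit_cotangent_S3 x" and nonzero: "X x \<noteq> 0" for x X
  proof -
    have "x \<in> cotangent_S3" "snd x \<bullet> snd x = 1" using x by (auto simp: unit_cotangent_S3_def)
    \<comment> \<open>Tangency removes the negative square, and the fibre norm is 1. The full
      \<open>X x \<bullet> X x\<close> contributed by the conformal factor gives strictness even for
      vectors with no fibre component.\<close>
    then have "hessian cotangent_S3 conformal_connection H X X x = snd (X x) \<bullet> snd (X x) + X x \<bullet> X x"
      using hessian_conformal[OF X] tangent_space_unit_cotangent_S3[OF x tangent] by (simp add: H_def)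
    also have "\<dots> > 0" using nonzero by (intro add_nonneg_pos) auto
    finally show ?thesis .
  qed
  moreover have "\<forall>x\<in>unit_cotangent_S3. \<Phi> (0, x) = x" by (simp add: \<Phi>_def)
  ultimately show ?thesis
    unfolding strictly_convex_hypersurface_def
    using diffeo riemannian_metric_conformal levi_civita_conformal zero_less_one[where 'a = real] by blast
qed

theorem proposition1p4:
  fixes c :: real
  assumes "c < 0"
  shows "contact_type_hypersurface cotangent_S3 omega_std (moser_regularization c) \<and>
    strictly_convex_hypersurface cotangent_S3 (moser_regularization c)"
  using contact_type_unit_cotangent_S3 strictly_convex_unit_cotangent_S3
  by (simp add: moser_regularization_unit_cotangent[OF assms])

end
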